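(* For every integer $n \ge 6$, the group $\Gamma_n^4$ is a finite $2$-step nilpotent $2$-group of order $2^{\binom{n}{3}}$. In fact, there is a central extension $$0 \longrightarrow \mathbb{Z}/2\mathbb{Z} \longrightarrow \Gamma_n^4 \longrightarrow H_1(\Gamma_n^4) \longrightarrow 1.$$
   Context: Let $[n]=\{1,2,\ldots,n\}$. For $n\ge 4$, the group $\Gamma_n^4$ is defined by the following presentation. The generators are the symbols $(ijkl)$, one for each ordered quadruple of distinct integers $i,j,k,l\in[n]$. The relations are: (1) $(ijkl)^2=1$; (2) $(ijkl)(stuv)=(stuv)(ijkl)$ whenever $|\{i,j,k,l\}\cap\{s,t,u,v\}|\le 2$; (3) $(ijkl)(ijlm)(jklm)(ijkm)(iklm)=1$ for all distinct $i,j,k,l,m\in[n]$; (4) $(ijkl)=(jkli)=(lkji)$. $H_1(\Gamma_n^4)$ denotes the abelianization of $\Gamma_n^4$. "$2$-step nilpotent" means nilpotent of class $2$ (non-abelian, with commutator subgroup contained in the center). *)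

theory Defs
  imports "HOL-Algebra.Elementary_Groups" "HOL-Algebra.Multiplicative_Group"
begin

section \<open>Groups given by generators and relations\<close>

text \<open>
  The letter \<open>(x, True)\<close> stands for the generator \<open>x\<close> and \<open>(x, False)\<close> for its formal inverse.
  A relation \<open>u = v\<close> is the pair \<open>(u, v)\<close>.
\<close>

type_synonym 'g word = "('g \<times> bool) list"

definition words :: "'g set \<Rightarrow> 'g word set" where
  "words S = lists (S \<times> UNIV)"

text \<open>
  The least congruence on the word monoid that makes \<open>x\<close> and its formal inverse cancel and
  identifies both sides of every relation. Quotienting by it gives the free group on \<open>S\<close> modulo
  the normal closure of the relators.
\<close>

inductive_set pres_cong :: "'g set \<Rightarrow> ('g word \<times> 'g word) set \<Rightarrow> ('g word \<times> 'g word) set"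
  for S :: "'g set" and R :: "('g word \<times> 'g word) set"
  where
    refl: "w \<in> words S \<Longrightarrow> (w, w) \<in> pres_cong S R"
  | sym: "(u, v) \<in> pres_cong S R \<Longrightarrow> (v, u) \<in> pres_cong S R"
  | trans: "(u, v) \<in> pres_cong S R \<Longrightarrow> (v, w) \<in> pres_cong S R \<Longrightarrow> (u, w) \<in> pres_cong S R"
  | append: "(u, u') \<in> pres_cong S R \<Longrightarrow> (v, v') \<in> pres_cong S R
      \<Longrightarrow> (u @ v, u' @ v') \<in> pres_cong S R"
  | cancel: "x \<in> S \<Longrightarrow> ([(x, b), (x, \<not> b)], []) \<in> pres_cong S R"
  | rel: "(u, v) \<in> R \<Longrightarrow> u \<in> words S \<Longrightarrow> v \<in> words S \<Longrightarrow> (u, v) \<in> pres_cong S R"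

definition presented_group ::
    "'g set \<Rightarrow> ('g word \<times> 'g word) set \<Rightarrow> 'g word set monoid" where
  "presented_group S R =
    \<lparr> carrier = words S // pres_cong S R,
      mult = (\<lambda>A B. \<Union>a\<in>A. \<Union>b\<in>B. pres_cong S R `` {a @ b}),
      one = pres_cong S R `` {[]} \<rparr>"

lemma pres_cong_in_words:
  assumes "(u, v) \<in> pres_cong S R"
  shows "u \<in> words S \<and> v \<in> words S"
  using assms by induction (auto simp: words_def)

lemma equiv_pres_cong: "equiv (words S) (pres_cong S R)"
proof (rule equivI)
  show "pres_cong S R \<subseteq> words S \<times> words S"
    using pres_cong_in_words by fast
  show "refl_on (words S) (pres_cong S R)"
    by (auto intro!: refl_onI pres_cong.refl)
  show "sym (pres_cong S R)"
    by (rule symI) (rule pres_cong.sym)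
  show "trans (pres_cong S R)"
    by (rule transI) (rule pres_cong.trans)
qed

lemma presented_group_mult:
  assumes "u \<in> words S" "v \<in> words S"
  shows "pres_cong S R `` {u} \<otimes>\<^bsub>presented_group S R\<^esub> pres_cong S R `` {v}
    = pres_cong S R `` {u @ v}"
proof -
  have "congruent2 (pres_cong S R) (pres_cong S R) (\<lambda>a b. pres_cong S R `` {a @ b})"
    by (rule congruent2I')
      (simp add: equiv_class_eq[OF equiv_pres_cong] pres_cong.append)
  then show ?thesis
    unfolding presented_group_def
    using UN_equiv_class2[OF equiv_pres_cong equiv_pres_cong _ assms] by simp
qed

lemma pres_cong_inverse:
  assumes "w \<in> words S"
  shows "(rev (map (\<lambda>(x, b). (x, \<not> b)) w) @ w, []) \<in> pres_cong S R"
  using assms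
proof (induction w)
  case Nil
  then show ?case by (simp add: pres_cong.refl)
next
  case (Cons a w)
  obtain x b where a: "a = (x, b)" by force
  have x: "x \<in> S" and w: "w \<in> words S" using Cons.prems a by (auto simp: words_def)
  let ?v = "rev (map (\<lambda>(x, b). (x, \<not> b)) w)"
  have v: "?v \<in> words S" using w by (auto simp: words_def)
  have "([(x, \<not> b), (x, b)], []) \<in> pres_cong S R"
    using pres_cong.cancel[OF x, of "\<not> b"] by simp
  from pres_cong.append[OF pres_cong.append[OF pres_cong.refl[OF v] this] pres_cong.refl[OF w]]
  have "(rev (map (\<lambda>(x, b). (x, \<not> b)) (a # w)) @ a # w, ?v @ w) \<in> pres_cong S R"
    by (simp add: a)
  then show ?case using Cons.IH[OF w] by (rule pres_cong.trans)
qed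

lemma group_presented_group: "group (presented_group S R)"
proof (rule groupI)
  let ?G = "presented_group S R"
  let ?c = "\<lambda>w. pres_cong S R `` {w}"
  have app: "u @ v \<in> words S" if "u \<in> words S" "v \<in> words S" for u v
    using that by (auto simp: words_def)
  have nil: "[] \<in> words S" by (simp add: words_def)
  have one: "\<one>\<^bsub>?G\<^esub> = ?c []" by (simp add: presented_group_def)
  have carr: "?c w \<in> carrier ?G" if "w \<in> words S" for w
    using that by (simp add: presented_group_def quotientI)
  have repr: "\<exists>w\<in>words S. A = ?c w" if "A \<in> carrier ?G" for A
    using that by (auto simp: presented_group_def elim: quotientE)
  show "\<one>\<^bsub>?G\<^esub> \<in> carrier ?G"
    using carr[OF nil] one by simp
  fix A assume "A \<in> carrier ?G"
  then obtain u where u: "u \<in> words S" "A = ?c u" using repr by blast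
  show "\<one>\<^bsub>?G\<^esub> \<otimes>\<^bsub>?G\<^esub> A = A"
    using u nil by (simp add: one presented_group_mult)
  have iw: "rev (map (\<lambda>(x, b). (x, \<not> b)) u) \<in> words S"
    using u by (auto simp: words_def)
  show "\<exists>B\<in>carrier ?G. B \<otimes>\<^bsub>?G\<^esub> A = \<one>\<^bsub>?G\<^esub>"
    using carr[OF iw] presented_group_mult[OF iw u(1), of R] u one
      equiv_class_eq[OF equiv_pres_cong pres_cong_inverse[OF u(1), of R]] by metis
  fix B assume "B \<in> carrier ?G"
  then obtain v where v: "v \<in> words S" "B = ?c v" using repr by blast
  show "A \<otimes>\<^bsub>?G\<^esub> B \<in> carrier ?G"
    using u v by (simp add: presented_group_mult app carr)
  fix C assume "C \<in> carrier ?G"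
  then obtain w where w: "w \<in> words S" "C = ?c w" using repr by blast
  show "A \<otimes>\<^bsub>?G\<^esub> B \<otimes>\<^bsub>?G\<^esub> C = A \<otimes>\<^bsub>?G\<^esub> (B \<otimes>\<^bsub>?G\<^esub> C)"
    using u v w by (simp add: presented_group_mult app)
qed


section \<open>The groups $\Gamma_n^4$\<close>

type_synonym quad = "nat \<times> nat \<times> nat \<times> nat"

definition gamma4_gens :: "nat \<Rightarrow> quad set" where
  "gamma4_gens n = {(i, j, k, l). {i, j, k, l} \<subseteq> {1..n} \<and> distinct [i, j, k, l]}"

abbreviation qgen :: "nat \<Rightarrow> nat \<Rightarrow> nat \<Rightarrow> nat \<Rightarrow> quad \<times> bool" where
  "qgen i j k l \<equiv> ((i, j, k, l), True)"

definition gamma4_rels :: "nat \<Rightarrow> (quad word \<times> quad word) set" where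
  "gamma4_rels n =
    {([qgen i j k l, qgen i j k l], []) | i j k l. (i, j, k, l) \<in> gamma4_gens n} \<union>
    {([qgen i j k l, qgen s t u v], [qgen s t u v, qgen i j k l]) | i j k l s t u v.
      (i, j, k, l) \<in> gamma4_gens n \<and> (s, t, u, v) \<in> gamma4_gens n \<and>
      card ({i, j, k, l} \<inter> {s, t, u, v}) \<le> 2} \<union>
    {([qgen i j k l, qgen i j l m, qgen j k l m, qgen i j k m, qgen i k l m], []) | i j k l m.
      {i, j, k, l, m} \<subseteq> {1..n} \<and> distinct [i, j, k, l, m]} \<union>
    {([qgen i j k l], [qgen j k l i]) | i j k l. (i, j, k, l) \<in> gamma4_gens n} \<union>
    {([qgen j k l i], [qgen l k j i]) | i j k l. (i, j, k, l) \<in> gamma4_gens n}"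

definition Gamma4 :: "nat \<Rightarrow> quad word set monoid" where
  "Gamma4 n = presented_group (gamma4_gens n) (gamma4_rels n)"


section \<open>Group-theoretic notions\<close>

definition center :: "('a, 'b) monoid_scheme \<Rightarrow> 'a set" where
  "center G = {z \<in> carrier G. \<forall>g\<in>carrier G. z \<otimes>\<^bsub>G\<^esub> g = g \<otimes>\<^bsub>G\<^esub> z}"

definition two_step_nilpotent :: "('a, 'b) monoid_scheme \<Rightarrow> bool" where
  "two_step_nilpotent G \<longleftrightarrow>
    group G \<and> \<not> comm_group G \<and> derived G (carrier G) \<subseteq> center G"

text \<open>\<^const>\<open>group.ord\<close> is \<open>0\<close> on elements of infinite order, so these are excluded.\<close>

definition p_group :: "nat \<Rightarrow> ('a, 'b) monoid_scheme \<Rightarrow> bool" where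
  "p_group p G \<longleftrightarrow> group G \<and> (\<forall>x\<in>carrier G. \<exists>k. group.ord G x = p ^ k)"

definition abelianization :: "('a, 'b) monoid_scheme \<Rightarrow> 'a set monoid" where
  "abelianization G = G Mod derived G (carrier G)"

definition abelianization_map :: "('a, 'b) monoid_scheme \<Rightarrow> 'a \<Rightarrow> 'a set" where
  "abelianization_map G g = derived G (carrier G) #>\<^bsub>G\<^esub> g"

definition central_extension ::
    "('a, 'm) monoid_scheme \<Rightarrow> ('b, 'n) monoid_scheme \<Rightarrow> ('c, 'o) monoid_scheme
      \<Rightarrow> ('a \<Rightarrow> 'b) \<Rightarrow> ('b \<Rightarrow> 'c) \<Rightarrow> bool" where
  "central_extension A G Q f p \<longleftrightarrow>
    group_hom A G f \<and> group_hom G Q p \<and>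
    inj_on f (carrier A) \<and>
    f ` carrier A = kernel G Q p \<and>
    p ` carrier G = carrier Q \<and>
    f ` carrier A \<subseteq> center G"

end

theory Submission
  imports Defs "HOL-Library.Nat_Bijection" "HOL-Computational_Algebra.Primes"
begin

text \<open>
  The order of \<open>\<Gamma>\<close> (for \<open>n \<ge> 6\<close>) is bounded from above by analysing commutators of generators and
  from below by an explicit action.

  \<^emph>\<open>Commutators.\<close> Generators whose supports share at most two points commute, so only supports that
  share a triple \<open>T\<close>, or coincide, matter. If \<open>a\<close> is supported on \<open>T \<union> {d}\<close> and \<open>g\<close> on \<open>T \<union> {e}\<close>, then a
  pentagon on \<open>T \<union> {e, f}\<close> with \<open>f \<noteq> d\<close> expresses a product \<open>g h\<close>, for suitable \<open>h\<close> supported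
  on \<open>T \<union> {f}\<close>, through generators that commute with \<open>a\<close>; hence \<open>g\<close> and \<open>h\<close> conjugate \<open>a\<close> in the same
  way. As a sixth point is available, it follows that the commutator of \<open>a\<close> and \<open>g\<close> depends on \<open>T\<close>
  alone (\<open>commutator_indep\<close>). The resulting element \<open>C T\<close> is equal to its inverse, it is central
  (\<open>C_commute\<close>), and comparing four pentagons on a five-point set shows that it does not depend on
  \<open>T\<close> either (\<open>C_eq\<close>). Generators with the same support commute. So all commutators lie in
  \<open>{1, \<zeta>}\<close> for one central \<open>\<zeta>\<close> with \<open>\<zeta>\<^sup>2 = 1\<close>.

  \<^emph>\<open>Upper bound.\<close> Modulo \<open>\<zeta>\<close> the group is elementary abelian. Adding one point \<open>N\<close> at a time,
  the pentagons starting at \<open>N\<close> show that it is generated by the elements \<open>(N b 1 d)\<close> with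
  \<open>2 \<le> b < d < N\<close> together with one element \<open>(N 1 b a)\<close> for each pair \<open>b < N\<close> in \<open>{2..n}\<close> other than
  \<open>2 < 3\<close> (\<open>quad_span\<close>). There are \<open>(n choose 3) - 1\<close> of them, so the order is at most
  \<open>2 ^ (n choose 3)\<close>.

  \<^emph>\<open>Lower bound.\<close> Take pairwise anticommuting involutions \<open>e\<^sub>T\<close>, one for each triple \<open>T\<close>, and
  involutions \<open>e\<^sub>P\<close> for the pairs \<open>P\<close> that commute with everything. Up to a sign that depends on the
  order of the indices, \<open>(i j k l)\<close> is sent to the product of the involutions of the four triples in
  \<open>{i, j, k, l}\<close> and of the two diagonals \<open>{i, k}\<close>, \<open>{j, l}\<close>. This respects all relations, sends
  \<open>\<zeta>\<close> to \<open>- 1\<close>, and keeps the chosen \<open>(n choose 3) - 1\<close> generators independent up to sign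
  (\<open>order_Gamma4_ge\<close>).
\<close>

section \<open>Commutators of generators\<close>

text \<open>
  A family of maps that satisfies the relations of \<open>\<Gamma>\<close>. Working with maps rather than with elements of
  a group turns all identities into equations between iterated applications, without side conditions
  on carriers; it is applied to left multiplication in \<open>\<Gamma>\<close>.
\<close>

locale quad_action =
  fixes n :: nat and X :: "nat \<Rightarrow> nat \<Rightarrow> nat \<Rightarrow> nat \<Rightarrow> 'a \<Rightarrow> 'a"
  assumes n_ge_6: "6 \<le> n"
    and square: "\<lbrakk>{i, j, k, l} \<subseteq> {1..n}; distinct [i, j, k, l]\<rbrakk> \<Longrightarrow> X i j k l (X i j k l y) = y"
    and far: "\<lbrakk>{i, j, k, l} \<subseteq> {1..n}; distinct [i, j, k, l]; {s, t, u, v} \<subseteq> {1..n};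
      distinct [s, t, u, v]; card ({i, j, k, l} \<inter> {s, t, u, v}) \<le> 2\<rbrakk>
      \<Longrightarrow> X i j k l (X s t u v y) = X s t u v (X i j k l y)"
    and pentagon: "\<lbrakk>{i, j, k, l, m} \<subseteq> {1..n}; distinct [i, j, k, l, m]\<rbrakk>
      \<Longrightarrow> X i j k l (X i j l m (X j k l m (X i j k m (X i k l m y)))) = y"
    and rotate: "\<lbrakk>{i, j, k, l} \<subseteq> {1..n}; distinct [i, j, k, l]\<rbrakk> \<Longrightarrow> X i j k l = X j k l i"
    and reflect: "\<lbrakk>{i, j, k, l} \<subseteq> {1..n}; distinct [i, j, k, l]\<rbrakk> \<Longrightarrow> X j k l i = X l k j i"
begin

text \<open>
  The generators with support \<open>A\<close>; a four-element set supports three of them, one for each way of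
  pairing off opposite vertices.
\<close>

definition Q :: "nat set \<Rightarrow> ('a \<Rightarrow> 'a) set" where
  "Q A = {X i j k l | i j k l. {i, j, k, l} = A \<and> distinct [i, j, k, l]}"

lemma Q_I: "{i, j, k, l} = A \<Longrightarrow> distinct [i, j, k, l] \<Longrightarrow> X i j k l \<in> Q A"
  unfolding Q_def by blast

lemma Q_square: "a \<in> Q A \<Longrightarrow> A \<subseteq> {1..n} \<Longrightarrow> a (a y) = y"
  unfolding Q_def by (clarify, rule square) simp_all

lemma Q_far:
  assumes "a \<in> Q A" "b \<in> Q B" "A \<subseteq> {1..n}" "B \<subseteq> {1..n}" "card (A \<inter> B) \<le> 2"
  shows "a (b y) = b (a y)"
proof -
  obtain i j k l where "a = X i j k l" "{i, j, k, l} = A" "distinct [i, j, k, l]"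
    using assms(1) unfolding Q_def by blast
  moreover obtain s t u v where "b = X s t u v" "{s, t, u, v} = B" "distinct [s, t, u, v]"
    using assms(2) unfolding Q_def by blast
  ultimately show ?thesis
    using far[of i j k l s t u v y] assms(3-5) by simp
qed

lemma reflect':
  assumes "{i, j, k, l} \<subseteq> {1..n}" "distinct [i, j, k, l]"
  shows "X i j k l = X i l k j"
proof -
  have "X i j k l = X l k j i"
    using rotate[of i j k l] reflect[of i j k l] assms by simp
  also have "\<dots> = X i l k j"
    by (rule rotate[symmetric]) (use assms in auto)
  finally show ?thesis .
qed

lemma Q_cases:
  assumes a: "a \<in> Q {d, p, q, r}" and A: "{d, p, q, r} \<subseteq> {1..n}" "distinct [d, p, q, r]"
  obtains "a = X d q p r" | "a = X d p q r" | "a = X d p r q"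
proof -
  have d_first: "\<exists>j k l. a = X d j k l \<and> {j, k, l} = {p, q, r}"
  proof -
    obtain i j k l where a': "a = X i j k l" "{i, j, k, l} = {d, p, q, r}" "distinct [i, j, k, l]"
      using a unfolding Q_def by blast
    then have sub: "{i, j, k, l} \<subseteq> {1..n}" using A by simp
    have "X i j k l = X j k l i" "X j k l i = X k l i j" "X k l i j = X l i j k"
      by (rule rotate; use sub a'(3) in auto)+
    then have rot: "a = X i j k l" "a = X j k l i" "a = X k l i j" "a = X l i j k"
      using a'(1) by auto
    have "{i, j, k, l} - {d} = {p, q, r}" using a'(2) A by auto
    moreover have "d = i \<or> d = j \<or> d = k \<or> d = l" using a'(2) by auto
    moreover have "{i, j, k, l} - {i} = {j, k, l}" "{i, j, k, l} - {j} = {k, l, i}"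
      "{i, j, k, l} - {k} = {l, i, j}" "{i, j, k, l} - {l} = {i, j, k}"
      using a'(3) by auto
    ultimately show ?thesis
      using rot by metis
  qed
  then obtain j k l where a': "a = X d j k l" "{j, k, l} = {p, q, r}" by blast
  have "j \<in> {p, q, r}" "k \<in> {p, q, r}" "l \<in> {p, q, r}" "p \<in> {j, k, l}" "q \<in> {j, k, l}" "r \<in> {j, k, l}"
    using a'(2) by blast+
  then have "(j, k, l) \<in> {(p,q,r),(p,r,q),(q,p,r),(q,r,p),(r,p,q),(r,q,p)}"
    using A(2) by auto
  moreover have "X d r q p = X d p q r" "X d q r p = X d p r q" "X d r p q = X d q p r"
    by (rule reflect'; use A in auto)+
  ultimately show ?thesis
    using a'(1) that by auto
qed

text \<open>
  The pentagon on \<open>(e, p, f, q, r)\<close> contains just two generators that need not commute with \<open>a\<close>. They are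
  adjacent factors, so their product commutes with \<open>a\<close>, and both conjugate \<open>a\<close> in the same way. Note that
  \<open>e\<close> is opposite to \<open>q\<close> in one of them and \<open>f\<close> is opposite to \<open>r\<close> in the other.
\<close>

lemma conj_across_pentagon:
  assumes S: "{p, q, r, d, e, f} \<subseteq> {1..n}" "distinct [p, q, r, d, e, f]"
    and a: "a \<in> Q {d, p, q, r}"
  shows "X e p q r (a (X e p q r y)) = X f p r q (a (X f p r q y))"
proof -
  have A: "{d, p, q, r} \<subseteq> {1..n}" using S by auto
  have Q: "X e p f q \<in> Q {e, f, p, q}" "X e p f r \<in> Q {e, f, p, r}" "X e f q r \<in> Q {e, f, q, r}"
    by (rule Q_I; use S in auto)+
  have c: "X e p f q (a y) = a (X e p f q y)" "X e p f r (a y) = a (X e p f r y)"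
    "X e f q r (a y) = a (X e f q r y)" for y
    by (rule Q_far[OF Q(1) a] Q_far[OF Q(2) a] Q_far[OF Q(3) a]; use S in \<open>auto simp: Int_insert_left\<close>)+
  have "X p f q r = X f q r p"
    by (rule rotate) (use S in auto)
  also have "\<dots> = X f p r q"
    by (rule reflect') (use S in auto)
  finally have u: "X p f q r = X f p r q" .
  have sq: "X e p f q (X e p f q y) = y" "X e p f r (X e p f r y) = y"
    "X e f q r (X e f q r y) = y" "X e p q r (X e p q r y) = y" "X f p r q (X f p r q y) = y" for y
    by (rule square; use S in auto)+
  have "X e p f q (X e p q r (X p f q r (X e p f r (X e f q r y)))) = y" for y
    by (rule pentagon) (use S in auto)
  from this[of "X e f q r (X e p f r y)" for y]
  have "X e p f q (X e p q r (X f p r q y)) = X e f q r (X e p f r y)" for y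
    by (simp add: sq u)
  from arg_cong[OF this, of "X e p f q"]
  have P: "X e p q r (X f p r q y) = X e p f q (X e f q r (X e p f r y))" for y
    by (simp add: sq)
  have "X e p q r (X f p r q (a y)) = a (X e p q r (X f p r q y))" for y
    unfolding P using c by simp
  from this[of "X f p r q y"] show ?thesis
    by (metis sq)
qed

text \<open>
  Write \<open>T = {p, q, r}\<close>. A comparison as in \<open>conj_across_pentagon\<close> switches between \<open>e\<close> and \<open>f\<close> and
  changes the vertex of \<open>T\<close> that is opposite to the extra point. As \<open>T\<close> has three vertices, such comparisons
  connect all generators supported on \<open>T \<union> {e}\<close> or \<open>T \<union> {f}\<close>.
\<close>

lemma conj_indep_aux:
  assumes S: "{p, q, r, d, e, f} \<subseteq> {1..n}" "distinct [p, q, r, d, e, f]"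
    and a: "a \<in> Q {d, p, q, r}" and g: "g \<in> Q {e, p, q, r}" and h: "h \<in> Q {f, p, q, r}"
  shows "g (a (g y)) = h (a (h y))"
proof -
  define E where "E i j k = X e i j k (a (X e i j k y))" for i j k
  define F where "F i j k = X f i j k (a (X f i j k y))" for i j k
  have 1: "E p q r = F p r q" "E q r p = F q p r" "E r p q = F r q p"
      "E p r q = F p q r" "E q p r = F q r p" "E r q p = F r p q"
    unfolding E_def F_def by (rule conj_across_pentagon[where d = d and a = a]; use S a in \<open>auto simp: insert_commute\<close>)+
  have 2: "X x r q p = X x p q r" "X x q r p = X x p r q" "X x r p q = X x q p r"
    if "x \<in> {e, f}" for x
    by (rule reflect'; use S that in auto)+
  have 3: "E r q p = E p q r" "E q r p = E p r q" "E r p q = E q p r"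
     "F r q p = F p q r" "F q r p = F p r q" "F r p q = F q p r"
    unfolding E_def F_def using 2 by auto
  have g': "g = X e q p r \<or> g = X e p q r \<or> g = X e p r q"
    by (rule Q_cases[OF g]) (use S in auto)
  have h': "h = X f q p r \<or> h = X f p q r \<or> h = X f p r q"
    by (rule Q_cases[OF h]) (use S in auto)
  have "g (a (g y)) \<in> {E q p r, E p q r, E p r q}"
    using g' by (auto simp: E_def)
  moreover have "h (a (h y)) \<in> {F q p r, F p q r, F p r q}"
    using h' by (auto simp: F_def)
  ultimately show ?thesis
    using 1 3 by auto
qed

lemma fresh:
  assumes "finite B" "card B < n"
  obtains x where "x \<in> {1..n}" "x \<notin> B"
proof -
  have "\<not> {1..n} \<subseteq> B"
    using assms card_mono[of B "{1..n}"] by auto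
  then show ?thesis using that by blast
qed

lemma conj_indep:
  assumes T: "T \<subseteq> {1..n}" "card T = 3" and d: "d \<in> {1..n}" "d \<notin> T"
    and e: "e \<in> {1..n}" "e \<notin> T" "e \<noteq> d" and f: "f \<in> {1..n}" "f \<notin> T" "f \<noteq> d"
    and a: "a \<in> Q (insert d T)" and g: "g \<in> Q (insert e T)" and h: "h \<in> Q (insert f T)"
  shows "g (a (g y)) = h (a (h y))"
proof -
  obtain p q r where T': "T = {p, q, r}" "distinct [p, q, r]"
    using T(2) by (auto simp: card_3_iff)
  have *: "g (a (g y)) = h (a (h y))"
    if "e \<in> {1..n}" "e \<notin> T" "e \<noteq> d" "f \<in> {1..n}" "f \<notin> T" "f \<noteq> d" "e \<noteq> f"
       "g \<in> Q (insert e T)" "h \<in> Q (insert f T)" for e f g h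
    by (rule conj_indep_aux[of p q r d e f a g h]) (use that T T' d a in auto)
  show ?thesis
  proof (cases "e = f")
    case True
    \<comment> \<open>The supports agree, so compare both maps with a generator that involves a third point.\<close>
    have "finite (T \<union> {d, e})" "card (T \<union> {d, e}) < n"
      using T n_ge_6 card_Un_le[of T "{d, e}"] finite_subset[OF T(1)] card_insert_le_m1[of 2 "{e}" d] by auto
    then obtain x where x: "x \<in> {1..n}" "x \<notin> T \<union> {d, e}" by (rule fresh)
    obtain k where k: "k \<in> Q (insert x T)"
      using Q_I[of x p q r "insert x T"] T' x by auto
    show ?thesis
      using *[of e x g k] *[of f x h k] e f g h x k True by auto
  qed (use * e f g h in blast)
qed

lemma commutator_indep:
  assumes T: "T \<subseteq> {1..n}" "card T = 3"
    and d: "d \<in> {1..n}" "d \<notin> T" and e: "e \<in> {1..n}" "e \<notin> T" "e \<noteq> d"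
    and d': "d' \<in> {1..n}" "d' \<notin> T" and e': "e' \<in> {1..n}" "e' \<notin> T" "e' \<noteq> d'"
    and a: "a \<in> Q (insert d T)" and g: "g \<in> Q (insert e T)"
    and a': "a' \<in> Q (insert d' T)" and g': "g' \<in> Q (insert e' T)"
  shows "a (g (a (g y))) = a' (g' (a' (g' y)))"
proof -
  obtain p q r where T': "T = {p, q, r}" "distinct [p, q, r]"
    using T(2) by (auto simp: card_3_iff)
  \<comment> \<open>A point \<open>x\<close> other than \<open>d\<close> and \<open>d'\<close> allows one generator to be changed at a time.\<close>
  have "finite (T \<union> {d, d'})" "card (T \<union> {d, d'}) < n"
    using T n_ge_6 card_Un_le[of T "{d, d'}"] finite_subset[OF T(1)] card_insert_le_m1[of 2 "{d'}" d] by auto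
  then obtain x where x: "x \<in> {1..n}" "x \<notin> T \<union> {d, d'}" by (rule fresh)
  obtain k where k: "k \<in> Q (insert x T)"
    using Q_I[of x p q r "insert x T"] T' x by auto
  have "g (a (g y)) = k (a (k y))" "k (a' (k y)) = g' (a' (g' y))"
    using conj_indep[OF T d e x(1) _ _ a g k] conj_indep[OF T d' x(1) _ _ e' a' k g'] x by auto
  moreover have "a (k (a z)) = a' (k (a' z))" for z
    using conj_indep[OF T x(1) _ d _ d' _ k a a'] x by auto
  ultimately show ?thesis by simp
qed

text \<open>
  The common commutator of all pairs of generators whose supports intersect exactly in the triple \<open>T\<close>.
  The lemma \<open>C_eqI\<close> says that any such pair may be used to compute it.
\<close>

definition C :: "nat set \<Rightarrow> 'a \<Rightarrow> 'a" where
  "C T = (SOME c. \<exists>d e a g. d \<in> {1..n} - T \<and> e \<in> {1..n} - T \<and> d \<noteq> e \<and>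
      a \<in> Q (insert d T) \<and> g \<in> Q (insert e T) \<and> c = (\<lambda>y. a (g (a (g y)))))"

lemma C_eqI:
  assumes T: "T \<subseteq> {1..n}" "card T = 3"
    and d: "d \<in> {1..n}" "d \<notin> T" and e: "e \<in> {1..n}" "e \<notin> T" "d \<noteq> e"
    and a: "a \<in> Q (insert d T)" and g: "g \<in> Q (insert e T)"
  shows "C T = (\<lambda>y. a (g (a (g y))))"
  unfolding C_def
proof (rule some_equality)
  fix c assume "\<exists>d e a g. d \<in> {1..n} - T \<and> e \<in> {1..n} - T \<and> d \<noteq> e \<and>
      a \<in> Q (insert d T) \<and> g \<in> Q (insert e T) \<and> c = (\<lambda>y. a (g (a (g y))))"
  then obtain d' e' a' g' where *: "d' \<in> {1..n}" "d' \<notin> T" "e' \<in> {1..n}" "e' \<notin> T" "e' \<noteq> d'"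
      "a' \<in> Q (insert d' T)" "g' \<in> Q (insert e' T)" "c = (\<lambda>y. a' (g' (a' (g' y))))" by auto
  show "c = (\<lambda>y. a (g (a (g y))))"
    unfolding *(8)
    by (rule ext, rule commutator_indep[of T d' e' d e a' g' a g]) (use * assms in auto)
qed (use assms in blast)

lemma C_obtain:
  assumes T: "T \<subseteq> {1..n}" "card T = 3" and d: "d \<in> {1..n}" "d \<notin> T"
    and a: "a \<in> Q (insert d T)"
  obtains e g where "e \<in> {1..n}" "e \<notin> T" "e \<noteq> d" "g \<in> Q (insert e T)"
    "C T = (\<lambda>y. a (g (a (g y))))" "C T = (\<lambda>y. g (a (g (a y))))"
proof -
  obtain p q r where T': "T = {p, q, r}" "distinct [p, q, r]"
    using T(2) by (auto simp: card_3_iff)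
  have "finite (T \<union> {d})" "card (T \<union> {d}) < n"
    using T n_ge_6 card_Un_le[of T "{d}"] finite_subset[OF T(1)] by auto
  then obtain e where e: "e \<in> {1..n}" "e \<notin> T \<union> {d}" by (rule fresh)
  obtain g where g: "g \<in> Q (insert e T)"
    using Q_I[of e p q r "insert e T"] T' e by auto
  show ?thesis
    by (rule that[OF _ _ _ g C_eqI[OF T d _ _ _ a g] C_eqI[OF T _ _ d _ g a]]) (use e in auto)
qed

lemma C_square:
  assumes T: "T \<subseteq> {1..n}" "card T = 3"
  shows "C T (C T y) = y"
proof -
  obtain p q r where T': "T = {p, q, r}" "distinct [p, q, r]"
    using T(2) by (auto simp: card_3_iff)
  obtain d where d: "d \<in> {1..n}" "d \<notin> T"
    using fresh[of T] T n_ge_6 finite_subset[OF T(1)] by auto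
  obtain a where a: "a \<in> Q (insert d T)"
    using Q_I[of d p q r "insert d T"] T' d by auto
  obtain e g where e: "e \<in> {1..n}" "e \<notin> T" "e \<noteq> d" and g: "g \<in> Q (insert e T)"
    and C: "C T = (\<lambda>y. a (g (a (g y))))" "C T = (\<lambda>y. g (a (g (a y))))"
    by (rule C_obtain[OF T d a])
  have "C T (C T y) = a (g (a (g (g (a (g (a y)))))))"
    by (subst C(1), subst C(2)) simp
  also have "\<dots> = y"
    using Q_square[OF a] Q_square[OF g] T d e by simp
  finally show ?thesis .
qed

lemma C_swap:
  assumes T: "T \<subseteq> {1..n}" "card T = 3"
    and d: "d \<in> {1..n}" "d \<notin> T" and e: "e \<in> {1..n}" "e \<notin> T" "d \<noteq> e"
    and a: "a \<in> Q (insert d T)" and g: "g \<in> Q (insert e T)"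
  shows "a (g y) = C T (g (a y))"
  using C_eqI[OF assms] Q_square[OF a] Q_square[OF g] T d e by simp

lemma C_over:
  assumes T: "T \<subseteq> {1..n}" "card T = 3" and d: "d \<in> {1..n}" "d \<notin> T"
    and a: "a \<in> Q (insert d T)"
  shows "a (C T y) = C T (a y)"
proof -
  obtain e g where e: "e \<in> {1..n}" "e \<notin> T" "e \<noteq> d" and g: "g \<in> Q (insert e T)"
    and C: "C T = (\<lambda>y. a (g (a (g y))))" "C T = (\<lambda>y. g (a (g (a y))))"
    by (rule C_obtain[OF T d a])
  have "a (C T y) = g (a (g y))"
    using Q_square[OF a] T d by (simp add: C(1))
  also have "\<dots> = C T (a y)"
    using Q_square[OF a] T d by (simp add: C(2))
  finally show ?thesis .
qed

section \<open>Centrality of the commutators\<close>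

text \<open>
  The remaining obstacle to centrality are generators that meet \<open>T = {p, q, r}\<close> in two points. If the
  points \<open>p\<close> and \<open>r\<close> of \<open>T\<close> are adjacent in the generator, conjugate the pentagon on
  \<open>(e, f, p, q, r)\<close> by a generator supported on \<open>T \<union> {d}\<close>: this puts \<open>C T\<close> on both sides of it.
\<close>

lemma C_commute_adjacent:
  assumes S: "{p, q, r, e, f} \<subseteq> {1..n}" "distinct [p, q, r, e, f]"
  shows "X e f p r (C {p, q, r} y) = C {p, q, r} (X e f p r y)"
proof -
  let ?T = "{p, q, r}"
  let ?c = "C ?T"
  have T: "?T \<subseteq> {1..n}" "card ?T = 3" using S by auto
  have "finite {p, q, r, e, f}" "card {p, q, r, e, f} < n" using S n_ge_6 by auto
  then obtain d where d: "d \<in> {1..n}" "d \<notin> {p, q, r, e, f}" by (rule fresh)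
  define a c1 c2 u t w where defs: "a = X d p q r" "c1 = X e f p q" "c2 = X e f q r"
    "u = X f p q r" "t = X e f p r" "w = X e p q r"
  have Q: "a \<in> Q {d, p, q, r}" "u \<in> Q {f, p, q, r}" "w \<in> Q {e, p, q, r}"
    "c1 \<in> Q {e, f, p, q}" "c2 \<in> Q {e, f, q, r}" "t \<in> Q {e, f, p, r}"
    unfolding defs by (rule Q_I; use S d in auto)+
  have sq: "a (a y) = y" "c1 (c1 y) = y" "c2 (c2 y) = y" "u (u y) = y" "w (w y) = y" for y
    unfolding defs by (rule square; use S d in auto)+
  have pent: "c1 (c2 (u (t (w y)))) = y" for y
    unfolding defs by (rule pentagon) (use S in auto)
  have far: "a (c1 y) = c1 (a y)" "a (c2 y) = c2 (a y)" "a (t y) = t (a y)" for y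
    by (rule Q_far[OF Q(1) Q(4)] Q_far[OF Q(1) Q(5)] Q_far[OF Q(1) Q(6)];
        use S d in \<open>auto simp: Int_insert_left\<close>)+
  have sw: "a (u y) = ?c (u (a y))" "a (w y) = ?c (w (a y))" for y
    by (rule C_swap[OF T _ _ _ _ _ Q(1) Q(2)] C_swap[OF T _ _ _ _ _ Q(1) Q(3)]; use S d in auto)+
  have cu: "u (?c y) = ?c (u y)" for y
    by (rule C_over[OF T _ _ Q(2)]) (use S in auto)
  have "t z = ?c (t (?c z))" for z
  proof -
    have "u (t (w (a x))) = ?c (u (t (?c (w (a x)))))" for x
    proof -
      have "c1 (c2 (u (t (w (a x))))) = a (c1 (c2 (u (t (w x)))))"
        by (simp add: pent)
      then have "u (t (w (a x))) = a (u (t (w x)))"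
        unfolding far by (metis sq(2,3))
      then show ?thesis by (simp add: sw far)
    qed
    from this[of "a (w z)"] have "u (t z) = u (?c (t (?c z)))"
      by (simp add: sq cu)
    then show ?thesis by (metis sq(4))
  qed
  then show ?thesis
    using C_square[OF T] unfolding defs by metis
qed

text \<open>
  If \<open>p\<close> and \<open>r\<close> are opposite in the generator, write \<open>C T\<close> as a commutator of \<open>a\<close> and \<open>w\<close> such that
  \<open>t\<close> commutes with \<open>a\<close>, while the correction from moving \<open>t\<close> past \<open>w\<close> is \<open>C {e, p, r}\<close>; it occurs
  twice and cancels by the case of adjacent points.
\<close>

lemma C_commute_opposite:
  assumes S: "{p, q, r, e, f} \<subseteq> {1..n}" "distinct [p, q, r, e, f]"
  shows "X e p f r (C {p, q, r} y) = C {p, q, r} (X e p f r y)"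
proof -
  let ?T = "{p, q, r}" and ?T' = "{e, p, r}"
  have T: "?T \<subseteq> {1..n}" "card ?T = 3" "?T' \<subseteq> {1..n}" "card ?T' = 3" using S by auto
  have "finite {p, q, r, e, f}" "card {p, q, r, e, f} < n" using S n_ge_6 by auto
  then obtain d where d: "d \<in> {1..n}" "d \<notin> {p, q, r, e, f}" by (rule fresh)
  define a t w where defs: "a = X q d p r" "t = X e p f r" "w = X e p q r"
  have Q: "a \<in> Q (insert d ?T)" "w \<in> Q (insert e ?T)" "w \<in> Q (insert q ?T')"
    "t \<in> Q (insert f ?T')"
    unfolding defs by (rule Q_I; use S d in auto)+
  have far: "t (a y) = a (t y)" for y
    by (rule Q_far[OF Q(4) Q(1)]) (use S d in \<open>auto simp: Int_insert_left\<close>)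
  have sw: "t (w y) = C ?T' (w (t y))" for y
    by (rule C_swap[OF T(3,4) _ _ _ _ _ Q(4) Q(3)]) (use S in auto)
  have cw: "w (C ?T' y) = C ?T' (w y)" for y
    by (rule C_over[OF T(3,4) _ _ Q(3)]) (use S in auto)
  have ca: "a (C ?T' y) = C ?T' (a y)" for y
  proof -
    have "X q d p r (C {p, e, r} y) = C {p, e, r} (X q d p r y)"
      by (rule C_commute_adjacent) (use S d in auto)
    then show ?thesis unfolding defs by (simp add: insert_commute)
  qed
  have C: "C ?T = (\<lambda>y. a (w (a (w y))))"
    by (rule C_eqI[OF T(1,2) _ _ _ _ _ Q(1,2)]) (use S d in auto)
  show ?thesis
    using far sw cw ca C_square[OF T(3,4)] unfolding C by (simp flip: defs(2))
qed

lemma C_commute: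
  assumes T: "T \<subseteq> {1..n}" "card T = 3" and B: "h \<in> Q B" "B \<subseteq> {1..n}"
  shows "h (C T y) = C T (h y)"
proof -
  have fin: "finite T" "finite B" using T B finite_subset by auto
  have cB: "card B = 4" using B(1) unfolding Q_def by auto
  have le3: "card (B \<inter> T) \<le> 3" using card_mono[of T "B \<inter> T"] fin T by auto
  consider "card (B \<inter> T) = 3" | "card (B \<inter> T) = 2" | "card (B \<inter> T) \<le> 1"
    using le3 by linarith
  then show ?thesis
  proof cases
    case 1
    then have "B \<inter> T = T" using card_subset_eq[of T "B \<inter> T"] fin T by auto
    then have "card (B - T) = 1" using card_Diff_subset[of T B] fin T cB by auto
    then obtain d where d: "B - T = {d}" by (auto simp: card_1_singleton_iff)
    then have "B = insert d T" "d \<notin> T" "d \<in> {1..n}" using \<open>B \<inter> T = T\<close> B by auto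
    then show ?thesis using C_over[OF T] B by auto
  next
    case 2
    then obtain p r where pr: "B \<inter> T = {p, r}" "p \<noteq> r" by (auto simp: card_2_iff)
    have "card (T - B) = 1" "card (B - T) = 2"
      using 2 card_Diff_subset_Int[of T B] card_Diff_subset_Int[of B T] fin T cB by (auto simp: Int_commute)
    then obtain q e f where qef: "T - B = {q}" "B - T = {e, f}" "e \<noteq> f"
      by (auto simp: card_2_iff card_1_singleton_iff)
    have *: "T = {p, q, r}" "T = {r, q, p}" "B = {e, f, p, r}" using qef pr by auto
    have S: "{p, q, r, e, f} \<subseteq> {1..n}" "distinct [p, q, r, e, f]"
      using T B * qef pr by auto
    have h: "h \<in> Q {e, f, p, r}" using B * by simp
    show ?thesis
    proof (rule Q_cases[OF h])
      assume "h = X e p f r"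
      then show ?thesis using C_commute_opposite[OF S] *(1) by simp
    next
      assume "h = X e f p r"
      then show ?thesis using C_commute_adjacent[OF S] *(1) by simp
    next
      assume "h = X e f r p"
      then show ?thesis using C_commute_adjacent[of r q p e f] S *(2) by auto
    qed (use S in auto)
  next
    case 3
    obtain p q r where T': "T = {p, q, r}" "distinct [p, q, r]"
      using T(2) by (auto simp: card_3_iff)
    obtain d where d: "d \<in> {1..n}" "d \<notin> T"
      using fresh[of T] fin T n_ge_6 by auto
    obtain a where a: "a \<in> Q (insert d T)"
      using Q_I[of d p q r "insert d T"] T' d by auto
    obtain e g where e: "e \<in> {1..n}" "e \<notin> T" "e \<noteq> d" and g: "g \<in> Q (insert e T)"
      and C: "C T = (\<lambda>y. a (g (a (g y))))"
      by (rule C_obtain[OF T d a])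
    have "card (B \<inter> insert x T) \<le> 2" for x
      using 3 fin by (simp add: Int_insert_right card_insert_if)
    then have "h (a y) = a (h y)" "h (g y) = g (h y)" for y
      using Q_far[OF B(1) a B(2)] Q_far[OF B(1) g B(2)] T d e by auto
    then show ?thesis by (simp add: C)
  qed
qed

section \<open>Uniqueness of the nontrivial commutator\<close>

lemma C_C_commute:
  assumes "T \<subseteq> {1..n}" "card T = 3" "T' \<subseteq> {1..n}" "card T' = 3"
  shows "C T (C T' y) = C T' (C T y)"
proof -
  obtain p q r where T': "T' = {p, q, r}" "distinct [p, q, r]"
    using assms(4) by (auto simp: card_3_iff)
  obtain d where d: "d \<in> {1..n}" "d \<notin> T'"
    using fresh[of T'] finite_subset[OF assms(3)] assms(4) n_ge_6 by auto
  have a: "X d p q r \<in> Q (insert d T')"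
    by (rule Q_I) (use T' d in auto)
  obtain e g where e: "e \<in> {1..n}" "e \<notin> T'" "e \<noteq> d" and g: "g \<in> Q (insert e T')"
    and C: "C T' = (\<lambda>y. X d p q r (g (X d p q r (g y))))"
    by (rule C_obtain[OF assms(3,4) d a])
  show ?thesis
    unfolding C using C_commute[OF assms(1,2) a] C_commute[OF assms(1,2) g] e d assms(3) by auto
qed

text \<open>
  By the pentagon, \<open>a = (i j k l)\<close> is a product of four generators each of which shares a different
  triple of \<open>{i, j, k, l}\<close> with it. Conjugation by any generator \<open>b\<close> of the same support thus multiplies \<open>a\<close>
  by the product of the four elements \<open>C\<close>; the choice \<open>b = a\<close> shows that this product is trivial.
\<close>

lemma same_support_commute:
  assumes S: "{i, j, k, l} \<subseteq> {1..n}" "distinct [i, j, k, l]" and b: "b \<in> Q {i, j, k, l}"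
  shows "b (X i j k l y) = X i j k l (b y)"
proof -
  have "finite {i, j, k, l}" "card {i, j, k, l} < n" using S n_ge_6 by auto
  then obtain m where m: "m \<in> {1..n}" "m \<notin> {i, j, k, l}" by (rule fresh)
  define a s t u v where defs: "a = X i j k l" "s = X i j l m" "t = X j k l m" "u = X i j k m"
    "v = X i k l m"
  have Q: "a \<in> Q {i, j, k, l}" "s \<in> Q {i, j, l, m}" "t \<in> Q {j, k, l, m}" "u \<in> Q {i, j, k, m}"
    "v \<in> Q {i, k, l, m}"
    unfolding defs by (rule Q_I; use S m in auto)+
  have sub: "{i, j, k, l} \<subseteq> {1..n}" "{i, j, l, m} \<subseteq> {1..n}" "{j, k, l, m} \<subseteq> {1..n}"
    "{i, j, k, m} \<subseteq> {1..n}" "{i, k, l, m} \<subseteq> {1..n}"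
    using S m by auto
  define ijl jkl ijk ikl where C: "ijl = C {i, j, l}" "jkl = C {j, k, l}" "ijk = C {i, j, k}"
    "ikl = C {i, k, l}"
  have sw: "c (s y) = ijl (s (c y))" "c (t y) = jkl (t (c y))" "c (u y) = ijk (u (c y))"
    "c (v y) = ikl (v (c y))" if c: "c \<in> Q {i, j, k, l}" for c y
    unfolding C
    by (rule C_swap[of "{i, j, l}" k m c s] C_swap[of "{j, k, l}" i m c t]
        C_swap[of "{i, j, k}" l m c u] C_swap[of "{i, k, l}" j m c v];
        use S m c Q in \<open>auto simp: insert_commute\<close>)+
  have cen: "g (ijl y) = ijl (g y)" "g (jkl y) = jkl (g y)" "g (ijk y) = ijk (g y)"
      "g (ikl y) = ikl (g y)" if g: "g \<in> Q M" "M \<subseteq> {1..n}" for g M y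
    unfolding C by (rule C_commute[OF _ _ g]; use S in simp)+
  have conj: "c (s (t (u (v y)))) = ijl (jkl (ijk (ikl (s (t (u (v (c y))))))))"
    if "c \<in> Q {i, j, k, l}" for c y
    using sw[OF that] by (simp add: cen[OF Q(2) sub(2)] cen[OF Q(3) sub(3)] cen[OF Q(4) sub(4)] cen[OF Q(5) sub(5)])
  have a: "s (t (u (v y))) = a y" for y
  proof -
    have "a (s (t (u (v y)))) = y"
      unfolding defs by (rule pentagon) (use S m in auto)
    then show ?thesis using Q_square[OF Q(1) sub(1)] by metis
  qed
  have "ijl (jkl (ijk (ikl y))) = y" for y
    using conj[OF Q(1), of y] a Q_square[OF Q(1) sub(1)] by simp
  then show ?thesis
    using conj[OF b, of y] a unfolding defs by simp
qed

text \<open>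
  The four pentagons used here pass through the edge \<open>w p\<close>; their twenty factors are ten generators,
  each occurring twice. Two of the pentagons share \<open>D\<close> and \<open>F\<close>, the other two share \<open>H\<close> and \<open>J\<close>.
  Eliminating these gives \<open>A B E = K I G\<close> and \<open>B G I = E K A\<close>; reordering one equation into the other
  leaves \<open>C {w, p, s}\<close> and \<open>C {w, p, q}\<close> as corrections, while \<open>C {w, p, r}\<close> occurs twice and cancels.
\<close>

lemma C_eq_adjacent:
  assumes S: "{w, p, q, r, s} \<subseteq> {1..n}" "distinct [w, p, q, r, s]"
  shows "C {w, p, q} = C {w, p, s}"
proof
  fix y
  define A B D E F G H I J K where defs: "A = X w p r s" "B = X w p s q" "D = X p r s q"
    "E = X w p r q" "F = X w r s q" "G = X w p q r" "H = X p s q r" "I = X w p s r"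
    "J = X w s q r" "K = X w p q s"
  have QA: "A \<in> Q {w, p, r, s}" and QB: "B \<in> Q {w, p, q, s}" and QD: "D \<in> Q {p, q, r, s}"
    and QE: "E \<in> Q {w, p, q, r}" and QG: "G \<in> Q {w, p, q, r}" and QH: "H \<in> Q {p, q, r, s}"
    and QI: "I \<in> Q {w, p, r, s}" and QK: "K \<in> Q {w, p, q, s}"
    and QF: "F \<in> Q {w, q, r, s}" and QJ: "J \<in> Q {w, q, r, s}"
    unfolding defs by (rule Q_I; use S in auto)+
  have eqs: "X p q s r = D" "X w q s r = F" "X p r q s = H" "X w r q s = J"
    unfolding defs by (rule reflect'; use S in auto)+
  have sq: "A (A y) = y" "B (B y) = y" "D (D y) = y" "E (E y) = y" "G (G y) = y"
    "H (H y) = y" "I (I y) = y" "K (K y) = y" "F (F y) = y" "J (J y) = y" for y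
    unfolding defs by (rule square; use S in auto)+
  define wpq where "wpq = C {w, p, q}"
  define wps where "wps = C {w, p, s}"
  define wpr where "wpr = C {w, p, r}"
  define pqs where "pqs = C {p, q, s}"
  define prs where "prs = C {p, r, s}"
  define pqr where "pqr = C {p, q, r}"
  note Cdefs = wpq_def wps_def wpr_def pqs_def prs_def pqr_def
  have "{w, p, q} \<subseteq> {1..n} \<and> card {w, p, q} = 3" "{w, p, s} \<subseteq> {1..n} \<and> card {w, p, s} = 3"
    "{w, p, r} \<subseteq> {1..n} \<and> card {w, p, r} = 3" "{p, q, s} \<subseteq> {1..n} \<and> card {p, q, s} = 3"
    "{p, r, s} \<subseteq> {1..n} \<and> card {p, r, s} = 3" "{p, q, r} \<subseteq> {1..n} \<and> card {p, q, r} = 3"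
    using S by auto
  then have triple: "\<exists>T. T \<subseteq> {1..n} \<and> card T = 3 \<and> c = C T"
    if "c \<in> {wpq, wps, wpr, pqs, prs, pqr}" for c
    using that unfolding Cdefs by blast
  have sub: "{w, p, r, s} \<subseteq> {1..n}" "{w, p, q, s} \<subseteq> {1..n}" "{p, q, r, s} \<subseteq> {1..n}"
    "{w, p, q, r} \<subseteq> {1..n}"
    using S by auto
  have central: "g (c y) = c (g y)" if c: "c \<in> {wpq, wps, wpr, pqs, prs, pqr}"
      and g: "g \<in> {A, B, D, E, G, H, I, K}" for g c y
  proof -
    obtain M where "g \<in> Q M" "M \<subseteq> {1..n}"
      using g QA QB QD QE QG QH QI QK sub by blast
    then show ?thesis using triple[OF c] C_commute by metis
  qed
  have cen: "A (pqs z) = pqs (A z)" "K (prs z) = prs (K z)" "B (pqr z) = pqr (B z)"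
    "E (pqs z) = pqs (E z)" "A (wpr z) = wpr (A z)" "A (wpq z) = wpq (A z)" "B (wpr z) = wpr (B z)"
    "B (wpq z) = wpq (B z)" "G (wpr z) = wpr (G z)" "G (wpq z) = wpq (G z)" "I (wpq z) = wpq (I z)"
    for z
    by (rule central; simp)+
  have cc: "c (c' y) = c' (c y)" if "c \<in> {wpq, wps, wpr, pqs, prs, pqr}"
      "c' \<in> {wpq, wps, wpr, pqs, prs, pqr}" for c c' y
    using triple[OF that(1)] triple[OF that(2)] C_C_commute by metis
  have csq: "c (c y) = y" if "c \<in> {wpq, wps, wpr, pqs, prs, pqr}" for c y
    using triple[OF that] C_square by metis
  have swap: "g (h z) = C T (h (g z))"
    if "g \<in> Q M" "h \<in> Q N" "M = insert d T" "N = insert e T" "d \<notin> T" "e \<notin> T" "d \<noteq> e"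
      "M \<subseteq> {1..n}" "N \<subseteq> {1..n}" "card T = 3" for g h z M N d e T
    using C_swap[of T d e g h z] that by auto
  have BD: "B (D z) = pqs (D (B z))" for z
    unfolding Cdefs by (rule swap[OF QB QD, of w _ r]) (use S in auto)
  have AD: "A (D z) = prs (D (A z))" for z
    unfolding Cdefs by (rule swap[OF QA QD, of w _ q]) (use S in auto)
  have ID: "I (D z) = prs (D (I z))" for z
    unfolding Cdefs by (rule swap[OF QI QD, of w _ q]) (use S in auto)
  have KD: "K (D z) = pqs (D (K z))" for z
    unfolding Cdefs by (rule swap[OF QK QD, of w _ r]) (use S in auto)
  have BH: "B (H z) = pqs (H (B z))" for z
    unfolding Cdefs by (rule swap[OF QB QH, of w _ r]) (use S in auto)
  have KH: "K (H z) = pqs (H (K z))" for z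
    unfolding Cdefs by (rule swap[OF QK QH, of w _ r]) (use S in auto)
  have GH: "G (H z) = pqr (H (G z))" for z
    unfolding Cdefs by (rule swap[OF QG QH, of w _ s]) (use S in auto)
  have EH: "E (H z) = pqr (H (E z))" for z
    unfolding Cdefs by (rule swap[OF QE QH, of w _ s]) (use S in auto)
  have BA: "B (A z) = wps (A (B z))" for z
    unfolding Cdefs by (rule swap[OF QB QA, of q _ r]) (use S in auto)
  have GA: "G (A z) = wpr (A (G z))" for z
    unfolding Cdefs by (rule swap[OF QG QA, of q _ s]) (use S in auto)
  have KE: "K (E z) = wpq (E (K z))" for z
    unfolding Cdefs by (rule swap[OF QK QE, of s _ r]) (use S in auto)
  have IE: "I (E z) = wpr (E (I z))" for z
    unfolding Cdefs by (rule swap[OF QI QE, of s _ q]) (use S in auto)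
  have pent: "A (B (D (E (F z)))) = z" "B (G (H (I (J z)))) = z"
    "K (I (D (G (F z)))) = z" "E (K (H (A (J z)))) = z" for z
    unfolding eqs[symmetric] unfolding defs
    using pentagon[of w p r s q z] pentagon[of w p s q r z] pentagon[of w p q s r z]
      pentagon[of w p r q s z] S eqs[unfolded defs] by auto
  have ABE: "A (B (E z)) = K (I (G z))" for z
  proof -
    have "A (B (D (E z))) = K (I (D (G z)))"
      using pent(1,3)[of "F z"] by (simp add: sq)
    then have "pqs (prs (D (A (B (E z))))) = prs (pqs (D (K (I (G z)))))"
      by (simp add: BD AD ID KD cen)
    moreover have "pqs (prs x) = prs (pqs x)" "prs (prs x) = x" "pqs (pqs x) = x" for x
      by (rule cc csq; simp)+
    ultimately show ?thesis by (metis sq(3))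
  qed
  have BGI: "B (G (I z)) = E (K (A z))" for z
  proof -
    have "B (G (H (I z))) = E (K (H (A z)))"
      using pent(2,4)[of "J z"] by (simp add: sq)
    then have "pqr (pqs (H (B (G (I z))))) = pqs (pqr (H (E (K (A z)))))"
      by (simp add: BH GH EH KH cen)
    moreover have "pqr (pqs x) = pqs (pqr x)" "pqr (pqr x) = x" "pqs (pqs x) = x" for x
      by (rule cc csq; simp)+
    ultimately show ?thesis by (metis sq(6))
  qed
  have IA: "I (A z) = A (I z)" for z
    using same_support_commute[of w p r s I z] QI S unfolding defs by simp
  have GE: "G (E z) = E (G z)" for z
    unfolding defs(4)
    by (rule same_support_commute) (use QG S in \<open>auto simp: insert_commute\<close>)
  \<comment> \<open>Both equations as relations of length six; the second one is sorted into the first.\<close>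
  have 1: "A (B (E (G (I (K z))))) = z" for z
    by (simp add: ABE sq)
  have "y = B (G (I (A (K (E y)))))"
    by (simp add: BGI sq)
  also have "\<dots> = wpq (wpr (wpr (wps (A (B (E (G (I (K y)))))))))"
    by (simp add: IA GA BA KE IE GE cen)
  also have "\<dots> = wpq (wps y)"
  proof -
    have "wpr (wpr x) = x" for x
      by (rule csq) simp
    then show ?thesis by (simp add: 1)
  qed
  finally show "C {w, p, q} y = C {w, p, s} y"
    using csq[of wpq "wps y"] unfolding Cdefs by simp
qed

text \<open>
  Any two triples are connected by exchanging one point at a time.
\<close>

lemma C_eq:
  assumes "T \<subseteq> {1..n}" "card T = 3" "T' \<subseteq> {1..n}" "card T' = 3"
  shows "C T = C T'"
  using assms
proof (induction "card (T - T')" arbitrary: T)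
  case 0
  then have "finite T" "finite T'" using finite_subset by auto
  then have "T = T'" using 0 card_subset_eq[of T' T] by simp
  then show ?case by simp
next
  case (Suc m)
  have fin: "finite T" "finite T'" using Suc.prems finite_subset by auto
  have "card (T' - T) = card (T - T')"
    using card_le_sym_Diff[of T T'] card_le_sym_Diff[of T' T] fin Suc.prems by simp
  then obtain q s where q: "q \<in> T" "q \<notin> T'" and s: "s \<in> T'" "s \<notin> T"
    using Suc.hyps(2) by (metis Diff_iff card.empty ex_in_conv nat.distinct(1))
  have "card (T - {q}) = 2" using q Suc.prems fin by simp
  then obtain w p where wp: "T - {q} = {w, p}" "w \<noteq> p" by (auto simp: card_2_iff)
  then have T: "T = {w, p, q}" using q by auto
  have "finite (insert s T)" "card (insert s T) < n" using fin Suc.prems s n_ge_6 by auto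
  then obtain r where r: "r \<in> {1..n}" "r \<notin> insert s T" by (rule fresh)
  have q': "q \<noteq> w" "q \<noteq> p" using wp by auto
  have "C {w, p, q} = C {w, p, s}"
  proof (rule C_eq_adjacent[of w p q r s])
    show "{w, p, q, r, s} \<subseteq> {1..n}" using T r(1) s(1) Suc.prems(1,3) by blast
    have "s \<notin> {w, p, q}" "r \<notin> {w, p, q}" "r \<noteq> s" using r(2) s(2) unfolding T by auto
    then show "distinct [w, p, q, r, s]" using q' wp(2) by auto
  qed
  moreover have "C {w, p, s} = C T'"
  proof (rule Suc.hyps(1))
    have "{w, p, s} - T' = (T - T') - {q}" using T s q q' by auto
    then show "m = card ({w, p, s} - T')" using Suc.hyps(2) q fin by simp
    show "{w, p, s} \<subseteq> {1..n}" using T s(1) Suc.prems(1,3) by blast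
    have "s \<noteq> w" "s \<noteq> p" using s(2) T by auto
    then show "card {w, p, s} = 3" using wp(2) by auto
  qed (fact Suc.prems(3,4))+
  ultimately show ?case using T by simp
qed

text \<open>
  The central involution that is the commutator of any two non-commuting generators.
\<close>

definition Z :: "'a \<Rightarrow> 'a" where "Z = C {1, 2, 3}"

lemma C_eq_Z: "T \<subseteq> {1..n} \<Longrightarrow> card T = 3 \<Longrightarrow> C T = Z"
  unfolding Z_def using n_ge_6 by (intro C_eq) auto

lemma Z_commutator: "Z y = X 1 2 3 4 (X 1 2 3 5 (X 1 2 3 4 (X 1 2 3 5 y)))"
proof -
  have "X 1 2 3 4 \<in> Q (insert 4 {1, 2, 3})" "X 1 2 3 5 \<in> Q (insert 5 {1, 2, 3})"
    by (rule Q_I; force)+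
  from C_eqI[OF _ _ _ _ _ _ _ this] show ?thesis
    using n_ge_6 unfolding Z_def by simp
qed

lemma Z_square: "Z (Z y) = y"
  unfolding Z_def using n_ge_6 by (intro C_square) auto

lemma Z_commute: "a \<in> Q A \<Longrightarrow> A \<subseteq> {1..n} \<Longrightarrow> a (Z y) = Z (a y)"
  unfolding Z_def by (rule C_commute) (use n_ge_6 in auto)

lemma Q_swap:
  assumes a: "a \<in> Q A" "A \<subseteq> {1..n}" and b: "b \<in> Q B" "B \<subseteq> {1..n}"
  shows "a (b y) = (if card (A \<inter> B) = 3 then Z (b (a y)) else b (a y))"
proof -
  have fin: "finite A" "finite B" using a b finite_subset by auto
  have c4: "card A = 4" "card B = 4" using a(1) b(1) by (auto simp: Q_def)
  have "card (A \<inter> B) \<le> 4" using card_mono[of A "A \<inter> B"] fin c4 by auto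
  then consider "card (A \<inter> B) \<le> 2" | "card (A \<inter> B) = 3" | "card (A \<inter> B) = 4" by linarith
  then show ?thesis
  proof cases
    case 1
    then show ?thesis using Q_far[OF a(1) b(1) a(2) b(2)] by simp
  next
    case 2
    have "card (A - A \<inter> B) = 1" "card (B - A \<inter> B) = 1"
      using 2 fin c4 by (simp_all add: card_Diff_subset)
    then obtain d e where de: "A - A \<inter> B = {d}" "B - A \<inter> B = {e}" by (auto simp: card_1_singleton_iff)
    have AB: "A = insert d (A \<inter> B)" "B = insert e (A \<inter> B)" using de by auto
    have "a (b y) = C (A \<inter> B) (b (a y))"
      by (rule C_swap[of _ d e]) (use 2 a b AB de in auto)
    moreover have "C (A \<inter> B) = Z" by (rule C_eq_Z) (use a(2) 2 in auto)
    ultimately show ?thesis using 2 by simp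
  next
    case 3
    then have "A \<inter> B = A" "A \<inter> B = B"
      using card_subset_eq[of A "A \<inter> B"] card_subset_eq[of B "A \<inter> B"] fin c4 by auto
    then have "A = B" by simp
    moreover obtain i j k l where "b = X i j k l" "{i, j, k, l} = B" "distinct [i, j, k, l]"
      using b unfolding Q_def by blast
    ultimately show ?thesis using same_support_commute[of i j k l a y] a 3 by simp
  qed
qed

end

section \<open>Anticommuting involutions attached to triples\<close>

text \<open>
  The action of words induced by an action of the letters. The exponent of a letter is ignored, because
  the letters will act by involutions.
\<close>

definition word_act :: "('g \<Rightarrow> 's \<Rightarrow> 's) \<Rightarrow> 'g word \<Rightarrow> 's \<Rightarrow> 's" where
  "word_act \<phi> w = foldr (\<lambda>x. \<phi> (fst x)) w"

lemma word_act_simps [simp]: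
  "word_act \<phi> [] s = s" "word_act \<phi> (x # w) s = \<phi> (fst x) (word_act \<phi> w s)"
  "word_act \<phi> (u @ v) s = word_act \<phi> u (word_act \<phi> v s)"
  by (simp_all add: word_act_def)

lemma word_act_pres_cong:
  assumes "(u, v) \<in> pres_cong S R"
    and invol: "\<And>x s. x \<in> S \<Longrightarrow> \<phi> x (\<phi> x s) = s"
    and rel: "\<And>u v s. (u, v) \<in> R \<Longrightarrow> word_act \<phi> u s = word_act \<phi> v s"
  shows "word_act \<phi> u s = word_act \<phi> v s"
  using assms(1) by (induction arbitrary: s) (simp_all add: invol rel)

text \<open>
  A state is a signed set of triples and pairs, that is, a signed monomial in the involutions attached
  to them; \<open>True\<close> stands for the sign \<open>- 1\<close>.
\<close>

type_synonym state = "nat set set \<times> bool"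

definition neg :: "state \<Rightarrow> state" where
  "neg s = (fst s, \<not> snd s)"

text \<open>
  A linear order on the triples, used to sort monomials: \<open>T\<close> comes after \<open>U\<close>. It relates triples only,
  as pairs commute with everything. Any such order would do; the binary encoding
  of finite sets provides one for which every triple has only finitely many predecessors, so that signs
  are well behaved for infinite sets as well.
\<close>

definition behind :: "nat set \<Rightarrow> nat set \<Rightarrow> bool" where
  "behind T U \<longleftrightarrow> card T = 3 \<and> card U = 3 \<and> set_encode U < set_encode T"

text \<open>
  Left multiplication of a monomial by the involution attached to \<open>T\<close>: the sign counts the triples that
  \<open>T\<close> has to pass to reach its place.
\<close>

definition toggle :: "nat set \<Rightarrow> state \<Rightarrow> state" where
  "toggle T s = (sym_diff (fst s) {T}, snd s \<noteq> odd (card {U \<in> fst s. behind T U}))"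

lemma finite_behind: "finite {U. behind T U}"
proof (rule finite_subset)
  show "{U. behind T U} \<subseteq> set_decode ` {..<set_encode T}"
  proof
    fix U assume "U \<in> {U. behind T U}"
    then have "finite U" "set_encode U < set_encode T"
      by (auto simp: behind_def intro: card_ge_0_finite)
    then show "U \<in> set_decode ` {..<set_encode T}"
      by (metis image_eqI lessThan_iff set_encode_inverse)
  qed
qed simp

lemma neg_simps [simp]: "neg (neg s) = s" "neg s \<noteq> s" "fst (neg s) = fst s"
  by (simp_all add: neg_def prod_eq_iff)

lemma toggle_neg [simp]: "toggle T (neg s) = neg (toggle T s)"
  by (auto simp: toggle_def neg_def)

lemma fst_toggle [simp]: "fst (toggle T s) = sym_diff (fst s) {T}"
  by (simp add: toggle_def)

lemma odd_behind_toggle: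
  "odd (card {V \<in> fst (toggle U s). behind T V}) \<longleftrightarrow>
    (odd (card {V \<in> fst s. behind T V}) \<noteq> behind T U)"
proof -
  let ?A = "{V \<in> fst s. behind T V}"
  have fin: "finite ?A" by (rule finite_subset[OF _ finite_behind[of T]]) auto
  show ?thesis
  proof (cases "behind T U")
    case False
    then have "{V \<in> fst (toggle U s). behind T V} = ?A" by auto
    then show ?thesis using False by simp
  next
    case True
    show ?thesis
    proof (cases "U \<in> fst s")
      case U: True
      then have "?A = insert U {V \<in> fst (toggle U s). behind T V}" using True by auto
      moreover have "U \<notin> {V \<in> fst (toggle U s). behind T V}" using U by auto
      ultimately have "card ?A = Suc (card {V \<in> fst (toggle U s). behind T V})"
        using fin by (metis (no_types, lifting) card_insert_disjoint finite_insert)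
      then show ?thesis using True by simp
    next
      case U: False
      then have "{V \<in> fst (toggle U s). behind T V} = insert U ?A" using True by auto
      moreover have "U \<notin> ?A" using U by auto
      ultimately show ?thesis using True fin by (simp only: card_insert_disjoint) simp
    qed
  qed
qed

lemma toggle_toggle [simp]: "toggle T (toggle T s) = s"
proof -
  have "\<not> behind T T" by (simp add: behind_def)
  then have "snd (toggle T (toggle T s)) = snd s"
    using odd_behind_toggle[where T = T and U = T] by (auto simp: toggle_def)
  then show ?thesis by (auto simp: prod_eq_iff)
qed

lemma toggle_swap:
  "toggle T (toggle U s) =
    (if card T = 3 \<and> card U = 3 \<and> T \<noteq> U then neg (toggle U (toggle T s)) else toggle U (toggle T s))"
proof -
  have *: "snd (toggle T (toggle U s)) \<longleftrightarrow> (snd s \<noteq> odd (card {V \<in> fst s. behind U V}))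
      \<noteq> (odd (card {V \<in> fst s. behind T V}) \<noteq> behind T U)" for T U
    using odd_behind_toggle[where T = T and U = U and s = s] by (auto simp: toggle_def)
  have "behind T U \<noteq> behind U T" if "card T = 3" "card U = 3" "T \<noteq> U"
  proof -
    have "finite T" "finite U" using that by (auto intro: card_ge_0_finite)
    then have "set_encode T \<noteq> set_encode U" using that(3) set_encode_eq by blast
    then show ?thesis using that by (auto simp: behind_def)
  qed
  moreover have "\<not> behind T U \<and> \<not> behind U T" if "\<not> (card T = 3 \<and> card U = 3 \<and> T \<noteq> U)"
    using that by (auto simp: behind_def)
  ultimately show ?thesis
    using *[of T U] *[of U T] by (auto simp: prod_eq_iff neg_def)
qed

text \<open>
  The action of a generator. The product of the four triples changes its sign under odd permutations
  of \<open>i, j, k, l\<close>. So does, within the dihedral group of the square, the sign \<open>sgn (k - i) * sgn (l - j)\<close>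
  of the two diagonals; hence the signed product only depends on the square.
\<close>

definition quad_flip :: "quad \<Rightarrow> state \<Rightarrow> state" where
  "quad_flip = (\<lambda>(i, j, k, l) s. (if (k < i) \<noteq> (l < j) then neg else id)
     (toggle {i, j, k} (toggle {i, j, l} (toggle {i, k, l} (toggle {j, k, l}
       (toggle {i, k} (toggle {j, l} s)))))))"

lemma quad_flip_neg [simp]: "quad_flip q (neg s) = neg (quad_flip q s)"
  by (simp add: quad_flip_def split: prod.split)

text \<open>
  The ten triples (numbered from 2 to 11) and five pairs (numbered from 12 to 16) of a pentagon in the
  order in which the five generators toggle them. Numbering starts at 2 because the simplifier
  rewrites the numeral 1 to a successor.
\<close>

lemma sorted_pentagon:
  fixes f :: "nat \<Rightarrow> state \<Rightarrow> state"
  assumes swap: "\<And>a b s. a < b \<Longrightarrow> b < 17 \<Longrightarrow> 2 \<le> a \<Longrightarrow> f b (f a s) = (if b < 12 then neg (f a (f b s)) else f a (f b s))"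
    and sq: "\<And>a s. f a (f a s) = s"
    and neg: "\<And>a s. f a (neg s) = neg (f a s)"
  shows "f 2 (f 3 (f 4 (f 5 (f 12 (f 13 (f 3 (f 6 (f 7 (f 8 (f 14 (f 15 (f 5 (f 9 (f 8 (f 10
    (f 13 (f 16 (f 2 (f 6 (f 11 (f 9 (f 12 (f 15 (f 4 (f 11 (f 7 (f 10 (f 14 (f 16 s))))))))))))))))))))))))))))) = s"
  by (simp add: swap sq neg)


lemma quad_flip_pentagon:
  assumes d: "distinct [i, j, k, l, m]"
  shows "quad_flip (i, j, k, l) (quad_flip (i, j, l, m) (quad_flip (j, k, l, m)
    (quad_flip (i, j, k, m) (quad_flip (i, k, l, m) s)))) = s"
proof -
  let ?L = "[{i, j, k}, {i, j, l}, {i, k, l}, {j, k, l}, {i, j, m}, {i, l, m}, {j, l, m},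
    {j, k, m}, {k, l, m}, {i, k, m}, {i, k}, {j, l}, {i, l}, {j, m}, {k, m}]"
  \<comment> \<open>The letter \<open>a\<close> toggles the entry of \<open>?L\<close> at position \<open>a - 2\<close>.\<close>
  define f where "f a = toggle (?L ! (a - 2))" for a
  have "map card ?L = replicate 10 3 @ replicate 5 2"
    using d by (simp add: numeral_eq_Suc)
  then have card: "card (?L ! a) = (replicate 10 3 @ replicate 5 2) ! a" if "a < 15" for a
    using that nth_map[of a ?L card] by simp
  have dist: "distinct ?L"
    using d by (auto simp: doubleton_eq_iff insert_eq_iff)
  have swap: "f b (f a s) = (if b < 12 then neg (f a (f b s)) else f a (f b s))"
    if "a < b" "b < 17" "2 \<le> a" for a b s
  proof -
    have "?L ! (b - 2) \<noteq> ?L ! (a - 2)"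
      by (subst nth_eq_iff_index_eq[OF dist]) (use that in auto)
    moreover have "b - 2 < 10 \<longleftrightarrow> b < 12" "a - 2 < 10 \<longleftrightarrow> a < 12" using that by auto
    then have "card (?L ! (b - 2)) = (if b < 12 then 3 else 2)" "card (?L ! (a - 2)) = (if a < 12 then 3 else 2)"
      by (subst card; use that in \<open>simp add: nth_append\<close>)+
    ultimately show ?thesis
      using that toggle_swap[of "?L ! (b - 2)" "?L ! (a - 2)" s] unfolding f_def by auto
  qed
  have "f 2 (f 3 (f 4 (f 5 (f 12 (f 13 (f 3 (f 6 (f 7 (f 8 (f 14 (f 15 (f 5 (f 9 (f 8 (f 10
    (f 13 (f 16 (f 2 (f 6 (f 11 (f 9 (f 12 (f 15 (f 4 (f 11 (f 7 (f 10 (f 14 (f 16 s))))))))))))))))))))))))))))) = s"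
    by (rule sorted_pentagon) (use swap in \<open>simp_all add: f_def\<close>)
  then show ?thesis
    by (auto simp add: quad_flip_def f_def insert_commute)
qed

lemma face_toggles:
  assumes d: "distinct [i, j, k, l]"
  shows "toggle {i, j, l} (toggle {i, j, k} s) = neg (toggle {i, j, k} (toggle {i, j, l} s))"
    "toggle {i, k, l} (toggle {i, j, k} s) = neg (toggle {i, j, k} (toggle {i, k, l} s))"
    "toggle {j, k, l} (toggle {i, j, k} s) = neg (toggle {i, j, k} (toggle {j, k, l} s))"
    "toggle {i, k, l} (toggle {i, j, l} s) = neg (toggle {i, j, l} (toggle {i, k, l} s))"
    "toggle {j, k, l} (toggle {i, j, l} s) = neg (toggle {i, j, l} (toggle {j, k, l} s))"
    "toggle {j, k, l} (toggle {i, k, l} s) = neg (toggle {i, k, l} (toggle {j, k, l} s))"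
    and edge_toggles:
    "\<And>s. toggle {i, k} (toggle {i, j, k} s) = toggle {i, j, k} (toggle {i, k} s)"
    "\<And>s. toggle {i, k} (toggle {i, j, l} s) = toggle {i, j, l} (toggle {i, k} s)"
    "\<And>s. toggle {i, k} (toggle {i, k, l} s) = toggle {i, k, l} (toggle {i, k} s)"
    "\<And>s. toggle {i, k} (toggle {j, k, l} s) = toggle {j, k, l} (toggle {i, k} s)"
    "\<And>s. toggle {j, l} (toggle {i, j, k} s) = toggle {i, j, k} (toggle {j, l} s)"
    "\<And>s. toggle {j, l} (toggle {i, j, l} s) = toggle {i, j, l} (toggle {j, l} s)"
    "\<And>s. toggle {j, l} (toggle {i, k, l} s) = toggle {i, k, l} (toggle {j, l} s)"
    "\<And>s. toggle {j, l} (toggle {j, k, l} s) = toggle {j, k, l} (toggle {j, l} s)"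
    "\<And>s. toggle {j, l} (toggle {i, k} s) = toggle {i, k} (toggle {j, l} s)"
proof -
  have ne: "{i, j, l} \<noteq> {i, j, k}" "{i, k, l} \<noteq> {i, j, k}" "{j, k, l} \<noteq> {i, j, k}"
    "{i, k, l} \<noteq> {i, j, l}" "{j, k, l} \<noteq> {i, j, l}" "{j, k, l} \<noteq> {i, k, l}"
    using d by (auto simp: doubleton_eq_iff insert_eq_iff)
  have c: "card {i, j, k} = 3" "card {i, j, l} = 3" "card {i, k, l} = 3" "card {j, k, l} = 3"
    "card {i, k} = 2" "card {j, l} = 2" using d by auto
  show "toggle {i, j, l} (toggle {i, j, k} s) = neg (toggle {i, j, k} (toggle {i, j, l} s))"
    "toggle {i, k, l} (toggle {i, j, k} s) = neg (toggle {i, j, k} (toggle {i, k, l} s))"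
    "toggle {j, k, l} (toggle {i, j, k} s) = neg (toggle {i, j, k} (toggle {j, k, l} s))"
    "toggle {i, k, l} (toggle {i, j, l} s) = neg (toggle {i, j, l} (toggle {i, k, l} s))"
    "toggle {j, k, l} (toggle {i, j, l} s) = neg (toggle {i, j, l} (toggle {j, k, l} s))"
    "toggle {j, k, l} (toggle {i, k, l} s) = neg (toggle {i, k, l} (toggle {j, k, l} s))"
    unfolding toggle_swap[of "{i, j, l}" "{i, j, k}"] toggle_swap[of "{i, k, l}" "{i, j, k}"]
      toggle_swap[of "{j, k, l}" "{i, j, k}"] toggle_swap[of "{i, k, l}" "{i, j, l}"]
      toggle_swap[of "{j, k, l}" "{i, j, l}"] toggle_swap[of "{j, k, l}" "{i, k, l}"] c
    using ne by simp_all
qed (use d in \<open>subst toggle_swap; simp\<close>)+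

lemma quad_flip_square_rotate_reflect:
  assumes d: "distinct [i, j, k, l]"
  shows "quad_flip (i, j, k, l) (quad_flip (i, j, k, l) s) = s"
    and "quad_flip (i, j, k, l) s = quad_flip (j, k, l, i) s"
    and "quad_flip (i, j, k, l) s = quad_flip (l, k, j, i) s"
proof -
  note rules = face_toggles[OF d] edge_toggles[OF d]
  have sets: "{j, k, i} = {i, j, k}" "{j, l, i} = {i, j, l}" "{k, l, i} = {i, k, l}" "{k, i} = {i, k}"
    "{l, k, j} = {j, k, l}" "{l, k, i} = {i, k, l}" "{l, j, i} = {i, j, l}" "{k, j, i} = {i, j, k}"
    "{l, j} = {j, l}" by auto
  have ord: "l < j \<longleftrightarrow> \<not> j < l" "k < i \<longleftrightarrow> \<not> i < k" using d by auto
  show "quad_flip (i, j, k, l) (quad_flip (i, j, k, l) s) = s"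
    unfolding quad_flip_def prod.case by (simp add: rules)
  show "quad_flip (i, j, k, l) s = quad_flip (j, k, l, i) s"
    unfolding quad_flip_def prod.case unfolding sets(1-3) unfolding sets(4) ord by (simp add: rules)
  show "quad_flip (i, j, k, l) s = quad_flip (l, k, j, i) s"
    unfolding quad_flip_def prod.case unfolding sets(5-8) unfolding sets(4,9) ord by (simp add: rules)
qed

lemma toggle_quad_flip:
  assumes d: "distinct [i, j, k, l]"
  shows "toggle U (quad_flip (i, j, k, l) s) = (if card U = 3 \<and> U \<subseteq> {i, j, k, l}
    then neg (quad_flip (i, j, k, l) (toggle U s)) else quad_flip (i, j, k, l) (toggle U s))"
proof -
  have c: "card {i, j, k} = 3" "card {i, j, l} = 3" "card {i, k, l} = 3" "card {j, k, l} = 3"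
    "card {i, k} = 2" "card {j, l} = 2" using d by auto
  note sw = toggle_swap[of U "{i, j, k}"] toggle_swap[of U "{i, j, l}"] toggle_swap[of U "{i, k, l}"]
      toggle_swap[of U "{j, k, l}"] toggle_swap[of U "{i, k}"] toggle_swap[of U "{j, l}"]
  consider "card U = 3" "U \<subseteq> {i, j, k, l}" | "card U \<noteq> 3"
    | "card U = 3" "\<not> U \<subseteq> {i, j, k, l}" by blast
  then show ?thesis
  proof cases
    case 1
    have "card ({i, j, k, l} - U) = 1" using 1 d by (simp add: card_Diff_subset finite_subset)
    then obtain x where x: "{i, j, k, l} - U = {x}" by (auto simp: card_1_singleton_iff)
    then have "U = {i, j, k, l} - {x}" "x \<in> {i, j, k, l}" using 1(2) by auto
    then have "U = {i, j, k} \<or> U = {i, j, l} \<or> U = {i, k, l} \<or> U = {j, k, l}"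
      using d by (auto simp: insert_Diff_if)
    then show ?thesis
      using 1 unfolding quad_flip_def prod.case
      by (elim disjE) (simp_all add: face_toggles[OF d] edge_toggles[OF d])
  next
    case 2
    then show ?thesis unfolding quad_flip_def prod.case by (simp add: sw)
  next
    case 3
    then have "U \<noteq> {i, j, k}" "U \<noteq> {i, j, l}" "U \<noteq> {i, k, l}" "U \<noteq> {j, k, l}" by auto
    then show ?thesis using 3 unfolding quad_flip_def prod.case by (simp add: sw c)
  qed
qed

lemma quad_flip_swap:
  assumes d: "distinct [i, j, k, l]" "distinct [s, t, u, v]"
  shows "quad_flip (i, j, k, l) (quad_flip (s, t, u, v) x) = (if card ({i, j, k, l} \<inter> {s, t, u, v}) = 3
    then neg (quad_flip (s, t, u, v) (quad_flip (i, j, k, l) x))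
    else quad_flip (s, t, u, v) (quad_flip (i, j, k, l) x))"
proof -
  define A where "A = {i, j, k, l}"
  have c: "card {s, t, u} = 3" "card {s, t, v} = 3" "card {s, u, v} = 3" "card {t, u, v} = 3"
    "card {s, u} = 2" "card {t, v} = 2" using d by auto
  define g where "g = quad_flip (i, j, k, l)"
  have g: "g (toggle U y) = (if card U = 3 \<and> U \<subseteq> A then neg (toggle U (g y)) else toggle U (g y))" for U y
    unfolding g_def A_def using toggle_quad_flip[OF d(1)] by simp
  have q: "quad_flip (s, t, u, v) y = (if (u < s) \<noteq> (v < t) then neg else id)
     (toggle {s, t, u} (toggle {s, t, v} (toggle {s, u, v} (toggle {t, u, v}
       (toggle {s, u} (toggle {t, v} y))))))" for y
    by (simp add: quad_flip_def)
  have [simp]: "g (neg y) = neg (g y)" for y by (simp add: g_def)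
  show ?thesis
    unfolding A_def[symmetric] g_def[symmetric] q using d(2)
    by (simp add: g c Int_insert_right card_insert_if)
qed

section \<open>The lower bound for the order\<close>

lemma quad_flip_pres_cong:
  assumes "(u, v) \<in> pres_cong (gamma4_gens n) (gamma4_rels n)"
  shows "word_act quad_flip u s = word_act quad_flip v s"
  using assms
proof (rule word_act_pres_cong)
  show "quad_flip x (quad_flip x s) = s" if x: "x \<in> gamma4_gens n" for x s
  proof -
    obtain i j k l where "x = (i, j, k, l)" "distinct [i, j, k, l]"
      using x unfolding gamma4_gens_def by blast
    then show ?thesis using quad_flip_square_rotate_reflect(1) by blast
  qed
  show "word_act quad_flip u s = word_act quad_flip v s" if "(u, v) \<in> gamma4_rels n" for u v s
    using that unfolding gamma4_rels_def
  proof (elim UnE)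
    assume "(u, v) \<in> {([qgen i j k l, qgen i j k l], []) | i j k l. (i, j, k, l) \<in> gamma4_gens n}"
    then obtain i j k l where "u = [qgen i j k l, qgen i j k l]" "v = []" "distinct [i, j, k, l]"
      by (auto simp: gamma4_gens_def)
    then show ?thesis using quad_flip_square_rotate_reflect(1)[of i j k l s] by simp
  next
    assume "(u, v) \<in> {([qgen i j k l, qgen s t u v], [qgen s t u v, qgen i j k l]) | i j k l s t u v.
      (i, j, k, l) \<in> gamma4_gens n \<and> (s, t, u, v) \<in> gamma4_gens n \<and>
      card ({i, j, k, l} \<inter> {s, t, u, v}) \<le> 2}"
    then obtain i j k l a b c d where uv: "u = [qgen i j k l, qgen a b c d]" "v = [qgen a b c d, qgen i j k l]"
      and d: "distinct [i, j, k, l]" "distinct [a, b, c, d]" "card ({i, j, k, l} \<inter> {a, b, c, d}) \<le> 2"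
      by (auto simp: gamma4_gens_def)
    have "card ({i, j, k, l} \<inter> {a, b, c, d}) \<noteq> 3" using d(3) by linarith
    then show ?thesis
      using quad_flip_swap[OF d(1,2), of s] uv by simp
  next
    assume "(u, v) \<in> {([qgen i j k l, qgen i j l m, qgen j k l m, qgen i j k m, qgen i k l m], []) | i j k l m.
      {i, j, k, l, m} \<subseteq> {1..n} \<and> distinct [i, j, k, l, m]}"
    then obtain i j k l m where uv: "u = [qgen i j k l, qgen i j l m, qgen j k l m, qgen i j k m, qgen i k l m]"
      "v = []" and d: "distinct [i, j, k, l, m]"
      by auto
    then show ?thesis using quad_flip_pentagon[OF d, of s] by simp
  next
    assume "(u, v) \<in> {([qgen i j k l], [qgen j k l i]) | i j k l. (i, j, k, l) \<in> gamma4_gens n}"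
    then obtain i j k l where "u = [qgen i j k l]" "v = [qgen j k l i]" "distinct [i, j, k, l]"
      by (auto simp: gamma4_gens_def)
    then show ?thesis using quad_flip_square_rotate_reflect(2)[of i j k l s] by simp
  next
    assume "(u, v) \<in> {([qgen j k l i], [qgen l k j i]) | i j k l. (i, j, k, l) \<in> gamma4_gens n}"
    then obtain i j k l where "u = [qgen j k l i]" "v = [qgen l k j i]" "distinct [i, j, k, l]"
      by (auto simp: gamma4_gens_def)
    then show ?thesis using quad_flip_square_rotate_reflect(2,3)[of i j k l s] by simp
  qed
qed

text \<open>
  Indices for a basis of the quotient of \<open>\<Gamma>\<close> by \<open>\<zeta>\<close>: the triples of \<open>{2..n}\<close> and the pairs of
  \<open>{2..n}\<close> other than \<open>{2, 3}\<close>.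
\<close>

definition indices :: "nat \<Rightarrow> nat set set" where
  "indices n = {T. T \<subseteq> {2..n} \<and> card T = 3} \<union> ({T. T \<subseteq> {2..n} \<and> card T = 2} - {{2, 3}})"

text \<open>
  The generator attached to an index: \<open>(N b 1 d)\<close> for a triple \<open>b < d < N\<close>, and for a pair \<open>b < N\<close> the
  generator \<open>(N 1 b a)\<close>, in which \<open>N\<close> and \<open>b\<close> are opposite and \<open>a\<close> is the first point of \<open>{2..}\<close> other
  than \<open>b\<close>.
\<close>

definition basis :: "nat set \<Rightarrow> quad" where
  "basis T = (let N = Max T; b = Min T in
     if card T = 3 then (N, b, 1, Max (T - {N})) else (N, 1, b, if b = 2 then 3 else 2))"

lemma finite_indices: "finite (indices n)"
  by (rule finite_subset[of _ "Pow {2..n}"]) (auto simp: indices_def)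

lemma card_indices:
  assumes "3 \<le> n"
  shows "Suc (card (indices n)) = n choose 3"
proof -
  let ?A = "{T. T \<subseteq> {2..n} \<and> card T = 3}" and ?B = "{T. T \<subseteq> {2..n} \<and> card T = 2}"
  have fin: "finite ?A" "finite ?B" by (rule finite_subset[of _ "Pow {2..n}"]; auto)+
  have A: "card ?A = (n - 1) choose 3" and B: "card ?B = (n - 1) choose 2"
    using n_subsets[of "{2..n}"] by simp_all
  have B1: "{2, 3} \<in> ?B" using assms by auto
  have "card (indices n) = card ?A + card (?B - {{2, 3}})"
    unfolding indices_def by (rule card_Un_disjoint) (use fin in auto)
  moreover have "Suc (card (?B - {{2, 3}})) = card ?B"
    by (rule card_Suc_Diff1) (use fin B1 in auto)
  moreover have "n choose 3 = ((n - 1) choose 3) + ((n - 1) choose 2)"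
    using assms binomial_Suc_Suc[of "n - 1" 2] by (simp add: numeral_eq_Suc)
  ultimately show ?thesis using A B by simp
qed

lemma basis_triple: "b < d \<Longrightarrow> d < N \<Longrightarrow> basis {b, d, N} = (N, b, 1, d)"
  by (simp add: basis_def Let_def insert_Diff_if max_def min_def)

lemma basis_pair: "b < N \<Longrightarrow> basis {b, N} = (N, 1, b, if b = 2 then 3 else 2)"
  by (simp add: basis_def Let_def max_def min_def)

lemma indices_cases:
  assumes "T \<in> indices n"
  obtains (triple) b d N where "2 \<le> b" "b < d" "d < N" "N \<le> n" "T = {b, d, N}"
  | (pair) b N where "2 \<le> b" "b < N" "4 \<le> N" "N \<le> n" "T = {b, N}"
proof -
  have sub: "T \<subseteq> {2..n}" using assms by (auto simp: indices_def)
  consider "card T = 3" | "card T = 2" "T \<noteq> {2, 3}" using assms by (auto simp: indices_def)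
  then show ?thesis
  proof cases
    case 1
    then obtain x y z where T: "T = {x, y, z}" and d: "x \<noteq> y" "y \<noteq> z" "x \<noteq> z"
      by (auto simp: card_3_iff)
    have *: "thesis" if "u < v" "v < w" "T = {u, v, w}" for u v w
      by (rule triple[of u v w]) (use that sub in auto)
    from d consider "x < y" "y < z" | "x < z" "z < y" | "y < x" "x < z" | "y < z" "z < x"
      | "z < x" "x < y" | "z < y" "y < x" by linarith
    then show ?thesis
      by cases (use *[of x y z] *[of x z y] *[of y x z] *[of y z x] *[of z x y] *[of z y x]
        in \<open>simp_all add: T insert_commute\<close>)
  next
    case 2
    then obtain x y where T: "T = {x, y}" and d: "x \<noteq> y" by (auto simp: card_2_iff)
    have *: "thesis" if "u < v" "T = {u, v}" for u v
    proof (rule pair[of u v])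
      show "4 \<le> v"
      proof (rule ccontr)
        assume "\<not> 4 \<le> v"
        then have "v = 3" "u = 2" using that sub by auto
        then show False using 2 that by simp
      qed
    qed (use that sub in auto)
    from d consider "x < y" | "y < x" by linarith
    then show ?thesis
      by cases (use *[of x y] *[of y x] in \<open>simp_all add: T insert_commute\<close>)
  qed
qed

lemma basis_in_gens: "T \<in> indices n \<Longrightarrow> basis T \<in> gamma4_gens n"
  by (erule indices_cases) (auto simp: basis_triple basis_pair gamma4_gens_def)

text \<open>
  The set of triples and pairs that are toggled by a word an odd number of times.
\<close>

definition supp :: "quad word \<Rightarrow> nat set set" where
  "supp w = fst (word_act quad_flip w ({}, False))"

lemma fst_quad_flip:
  "fst (quad_flip (i, j, k, l) s) = sym_diff (fst s) (fst (quad_flip (i, j, k, l) ({}, False)))"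
proof -
  have sd: "sym_diff A (sym_diff B C) = sym_diff (sym_diff A B) C" for A B C :: "nat set set" by auto
  have id: "fst ((if P then neg else id) s) = fst s" for P s by simp
  show ?thesis
    unfolding quad_flip_def prod.case id fst_toggle fst_conv by (auto 0 0)
qed

lemma fst_word_act: "fst (word_act quad_flip w s) = sym_diff (fst s) (supp w)"
proof (induction w)
  case Nil
  then show ?case by (simp add: supp_def)
next
  case (Cons x w)
  obtain i j k l c where x: "x = ((i, j, k, l), c)" by (metis prod.exhaust)
  define D where "D = fst (quad_flip (i, j, k, l) ({}, False))"
  have D: "fst (quad_flip (i, j, k, l) t) = sym_diff (fst t) D" for t
    unfolding D_def by (rule fst_quad_flip)
  have "fst (word_act quad_flip w ({}, False)) = supp w" by (simp add: supp_def)
  then show ?case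
    unfolding supp_def word_act_simps x fst_conv D Cons by auto
qed

lemma supp_append: "supp (u @ v) = sym_diff (supp u) (supp v)"
  using fst_word_act[of u "word_act quad_flip v ({}, False)"] by (auto simp: supp_def)

lemma supp_gen:
  assumes "distinct [i, j, k, l]"
  shows "supp [qgen i j k l] = {{i, j, k}, {i, j, l}, {i, k, l}, {j, k, l}, {i, k}, {j, l}}"
proof -
  have id: "fst ((if P then neg else id) s) = fst s" for P s by simp
  have ne: "{i, j, k} \<noteq> {i, j, l}" "{i, j, k} \<noteq> {i, k, l}" "{i, j, k} \<noteq> {j, k, l}"
    "{i, j, l} \<noteq> {i, k, l}" "{i, j, l} \<noteq> {j, k, l}" "{i, k, l} \<noteq> {j, k, l}"
    "{i, k} \<noteq> {i, j, k}" "{i, k} \<noteq> {i, j, l}" "{i, k} \<noteq> {i, k, l}" "{i, k} \<noteq> {j, k, l}"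
    "{j, l} \<noteq> {i, j, k}" "{j, l} \<noteq> {i, j, l}" "{j, l} \<noteq> {i, k, l}" "{j, l} \<noteq> {j, k, l}"
    "{i, k} \<noteq> {j, l}"
    using assms by (auto simp: doubleton_eq_iff insert_eq_iff)
  show ?thesis
    unfolding supp_def quad_flip_def word_act_simps prod.case fst_conv id fst_toggle
    using ne by (simp add: insert_Diff_if insert_commute) 
qed

lemma supp_triple:
  assumes "2 \<le> b" "b < d" "d < N" "N \<le> n"
  shows "supp [(basis {b, d, N}, True)] \<inter> indices n = {{b, d, N}} \<union> ({{b, d}} \<inter> indices n)"
proof -
  have "{b, d, N} \<in> indices n"
    using assms by (auto simp: indices_def)
  moreover have "T \<notin> indices n" if "1 \<in> T" for T
    using that by (auto simp: indices_def)
  moreover have "supp [(basis {b, d, N}, True)] = {{N, b, 1}, {N, b, d}, {N, 1, d}, {b, 1, d}, {N, 1}, {b, d}}"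
    unfolding basis_triple[OF assms(2,3)] by (rule supp_gen) (use assms in auto)
  moreover have "{N, b, d} = {b, d, N}" by auto
  ultimately show ?thesis by auto
qed

lemma supp_pair:
  assumes "2 \<le> b" "b < N" "4 \<le> N" "N \<le> n"
  obtains T where "T \<in> indices n" "card T = 3" "T \<subseteq> {2..N}"
    "supp [(basis {b, N}, True)] \<inter> indices n = {{b, N}, T}"
proof -
  define a :: nat where "a = (if b = 2 then 3 else 2)"
  have "{b, N} \<in> indices n" "{N, b, a} \<in> indices n"
    using assms by (auto simp: indices_def a_def doubleton_eq_iff)
  moreover have "T \<notin> indices n" if "1 \<in> T" for T
    using that by (auto simp: indices_def)
  moreover have "supp [(basis {b, N}, True)] = {{N, 1, b}, {N, 1, a}, {N, b, a}, {1, b, a}, {N, b}, {1, a}}"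
    using assms unfolding basis_pair[OF assms(2)] a_def[symmetric] by (subst supp_gen) (auto simp: a_def)
  ultimately have "supp [(basis {b, N}, True)] \<inter> indices n = {{b, N}, {N, b, a}}"
    by (auto simp: insert_commute)
  then show ?thesis
    using that[of "{N, b, a}"] assms \<open>{N, b, a} \<in> indices n\<close> by (auto simp: a_def)
qed

text \<open>
  Restricted to the index set, the supports of the chosen generators are triangular: each contains its own
  index and at most one other index, which is either a pair with smaller maximum or a triple with the same
  maximum.
\<close>

lemma supports_singleton:
  assumes "T \<in> indices n"
  shows "\<exists>w\<in>words (gamma4_gens n). supp w \<inter> indices n = {T}"
proof -
  let ?R = "{supp w \<inter> indices n | w. w \<in> words (gamma4_gens n)}"
  have diff: "sym_diff A B \<in> ?R" if AB: "A \<in> ?R" "B \<in> ?R" for A B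
  proof -
    obtain u v where uv: "A = supp u \<inter> indices n" "B = supp v \<inter> indices n"
      "u \<in> words (gamma4_gens n)" "v \<in> words (gamma4_gens n)" using AB by blast
    have "sym_diff A B = supp (u @ v) \<inter> indices n" "u @ v \<in> words (gamma4_gens n)"
      using uv by (auto simp: supp_append words_def)
    then show ?thesis by blast
  qed
  have gen: "supp [(basis T, True)] \<inter> indices n \<in> ?R" if "T \<in> indices n" for T
    using basis_in_gens[OF that] by (force simp: words_def)
  have triples: "{T} \<in> ?R" if pairs: "\<And>P. P \<in> indices n \<Longrightarrow> card P = 2 \<Longrightarrow> P \<subseteq> {2..<N} \<Longrightarrow> {P} \<in> ?R"
    and T: "T \<in> indices n" "card T = 3" "T \<subseteq> {2..N}" for N T
    using T(1)
  proof (cases rule: indices_cases)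
    case (triple b d M)
    have s: "supp [(basis T, True)] \<inter> indices n = {T} \<union> ({{b, d}} \<inter> indices n)"
      using supp_triple[OF triple(1-4)] triple(5) by simp
    show ?thesis
    proof (cases "{b, d} \<in> indices n")
      case True
      then have "{{b, d}} \<in> ?R" by (rule pairs) (use triple T(3) in auto)
      moreover have "sym_diff ({T} \<union> ({{b, d}} \<inter> indices n)) {{b, d}} = {T}"
      proof -
        have "T \<noteq> {b, d}" using T(2) triple(2) by auto
        then show ?thesis using True by auto
      qed
      ultimately show ?thesis using diff[OF gen[OF T(1), unfolded s], of "{{b, d}}"] by (simp only:)
    next
      case False
      then show ?thesis using gen[OF T(1)] s by simp
    qed
  next
    case (pair b M)
    then show ?thesis using T(2) by simp
  qed
  have "{P} \<in> ?R" if "P \<in> indices n" "card P = 2" "P \<subseteq> {2..<N}" for P N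
    using that
  proof (induction N arbitrary: P rule: less_induct)
    case (less N)
    show ?case using less.prems(1)
    proof (cases rule: indices_cases)
      case (triple b d M)
      then show ?thesis using less.prems(2) by simp
    next
      case (pair b M)
      then have "M < N" using less.prems(3) by auto
      obtain T where T: "T \<in> indices n" "card T = 3" "T \<subseteq> {2..M}"
        "supp [(basis {b, M}, True)] \<inter> indices n = {{b, M}, T}"
        using supp_pair[OF pair(1-4)] .
      have "{T} \<in> ?R"
        by (rule triples[OF less.IH[OF \<open>M < N\<close>] T(1-3)])
      moreover have "{P, T} \<in> ?R" using gen[OF less.prems(1)] T(4) pair(5) by simp
      moreover have "sym_diff {P, T} {T} = {P}" using T(2) less.prems(2) by auto
      ultimately show ?thesis using diff[of "{P, T}" "{T}"] by (simp only:)
    qed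
  qed
  note pairs = this
  have "{T} \<in> ?R"
  proof (cases "card T = 3")
    case True
    show ?thesis
      by (rule triples[of n]) (use pairs assms True in \<open>auto simp: indices_def\<close>)
  next
    case False
    then show ?thesis
      by (intro pairs[of _ "Suc n"]) (use assms in \<open>auto simp: indices_def\<close>)
  qed
  then show ?thesis by auto
qed

lemma supports_subset:
  assumes "F \<subseteq> indices n"
  shows "\<exists>w\<in>words (gamma4_gens n). supp w \<inter> indices n = F"
  using finite_subset[OF assms finite_indices] assms
proof induction
  case empty
  have "supp [] = {}" "[] \<in> words (gamma4_gens n)" by (auto simp: supp_def words_def)
  then show ?case by blast
next
  case (insert T F)
  then obtain w where w: "w \<in> words (gamma4_gens n)" "supp w \<inter> indices n = F" by auto
  obtain v where v: "v \<in> words (gamma4_gens n)" "supp v \<inter> indices n = {T}"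
    using supports_singleton[of T n] insert.prems by auto
  have "v @ w \<in> words (gamma4_gens n)" using v(1) w(1) by (auto simp: words_def)
  moreover have "supp (v @ w) \<inter> indices n = insert T F"
    using v(2) w(2) insert.hyps(2) by (auto simp: supp_append)
  ultimately show ?case by blast
qed

text \<open>
  A commutator of two generators that share a triple; it acts as the sign \<open>- 1\<close>.
\<close>

definition sign_word :: "quad word" where
  "sign_word = [qgen 1 2 3 4, qgen 1 2 3 5, qgen 1 2 3 4, qgen 1 2 3 5]"

lemma sign_word_neg: "word_act quad_flip sign_word s = neg s"
proof -
  have "quad_flip (1, 2, 3, 4) (quad_flip (1, 2, 3, 5) t) = neg (quad_flip (1, 2, 3, 5) (quad_flip (1, 2, 3, 4) t))" for t
    by (subst quad_flip_swap) auto
  then show ?thesis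
    using quad_flip_square_rotate_reflect(1)[of 1 2 3 4] quad_flip_square_rotate_reflect(1)[of 1 2 3 5]
    by (simp add: sign_word_def)
qed

lemma sign_word_in: "5 \<le> n \<Longrightarrow> sign_word \<in> words (gamma4_gens n)"
  by (simp add: sign_word_def words_def gamma4_gens_def)

lemma order_Gamma4_ge:
  assumes n: "5 \<le> n" and fin: "finite (carrier (Gamma4 n))"
  shows "2 ^ (n choose 3) \<le> card (carrier (Gamma4 n))"
proof -
  let ?c = "\<lambda>w. pres_cong (gamma4_gens n) (gamma4_rels n) `` {w}"
  let ?base = "({}, False) :: state"
  \<comment> \<open>Prefixing the sign word changes the sign of the final state and nothing else.\<close>
  have ex: "\<exists>w\<in>words (gamma4_gens n). supp w \<inter> indices n = F \<and> snd (word_act quad_flip w ?base) = b"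
    if F: "F \<subseteq> indices n" for F b
  proof -
    obtain w where w: "w \<in> words (gamma4_gens n)" "supp w \<inter> indices n = F"
      using supports_subset[OF F] by auto
    have "sign_word @ w \<in> words (gamma4_gens n)" using sign_word_in[OF n] w by (simp add: words_def)
    moreover have "supp (sign_word @ w) = supp w" "snd (word_act quad_flip (sign_word @ w) ?base) \<longleftrightarrow>
        \<not> snd (word_act quad_flip w ?base)"
      by (simp_all add: supp_def sign_word_neg) (simp add: neg_def)
    ultimately show ?thesis using w by metis
  qed
  define W where "W = (\<lambda>(F, b). SOME w. w \<in> words (gamma4_gens n) \<and> supp w \<inter> indices n = F \<and>
    snd (word_act quad_flip w ?base) = b)"
  have W: "W (F, b) \<in> words (gamma4_gens n)" "supp (W (F, b)) \<inter> indices n = F"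
    "snd (word_act quad_flip (W (F, b)) ?base) = b" if "F \<subseteq> indices n" for F b
    using someI_ex[OF ex[OF that, of b, unfolded Bex_def]] unfolding W_def by auto
  have "inj_on (\<lambda>x. ?c (W x)) (Pow (indices n) \<times> UNIV)"
  proof (rule inj_onI, clarify)
    fix F b F' b'
    assume F: "F \<subseteq> indices n" "F' \<subseteq> indices n" and eq: "?c (W (F, b)) = ?c (W (F', b'))"
    have "(W (F, b), W (F', b')) \<in> pres_cong (gamma4_gens n) (gamma4_rels n)"
      using eq W(1) F by (metis eq_equiv_class equiv_pres_cong)
    then have "word_act quad_flip (W (F, b)) ?base = word_act quad_flip (W (F', b')) ?base"
      by (rule quad_flip_pres_cong)
    then show "F = F' \<and> b = b'" using W(2,3) F unfolding supp_def by metis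
  qed
  moreover have "(\<lambda>x. ?c (W x)) ` (Pow (indices n) \<times> UNIV) \<subseteq> carrier (Gamma4 n)"
    using W(1) by (auto simp: Gamma4_def presented_group_def intro: quotientI)
  ultimately have "card (Pow (indices n) \<times> (UNIV :: bool set)) \<le> card (carrier (Gamma4 n))"
    using fin by (rule card_inj_on_le)
  moreover have "card (Pow (indices n) \<times> (UNIV :: bool set)) = 2 ^ (Suc (card (indices n)))"
    using finite_indices[of n] by (simp add: card_cartesian_product card_Pow)
  ultimately show ?thesis using card_indices n by simp
qed

section \<open>Groups generated by involutions that commute up to a central sign\<close>

context group
begin

text \<open>
  The elements \<open>x\<close> and \<open>y\<close> commute up to a factor \<open>1\<close> or \<open>z\<close>.
\<close>

definition commute_upto :: "'a \<Rightarrow> 'a \<Rightarrow> 'a \<Rightarrow> bool" where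
  "commute_upto z x y \<longleftrightarrow> (\<exists>e\<in>{\<one>, z}. x \<otimes> y = e \<otimes> (y \<otimes> x))"

context
  fixes z
  assumes z: "z \<in> carrier G" "z \<otimes> z = \<one>" and central: "\<And>x. x \<in> carrier G \<Longrightarrow> x \<otimes> z = z \<otimes> x"
begin

lemma sign_facts:
  assumes "e \<in> {\<one>, z}"
  shows "e \<in> carrier G" "e \<otimes> e = \<one>" "\<And>x. x \<in> carrier G \<Longrightarrow> x \<otimes> e = e \<otimes> x"
    "\<And>x y. x \<in> carrier G \<Longrightarrow> y \<in> carrier G \<Longrightarrow> x \<otimes> (e \<otimes> y) = e \<otimes> (x \<otimes> y)"
    "\<And>x. x \<in> carrier G \<Longrightarrow> e \<otimes> (e \<otimes> x) = x"
proof -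
  show e: "e \<in> carrier G" and ee: "e \<otimes> e = \<one>" using assms z by auto
  show c: "x \<otimes> e = e \<otimes> x" if "x \<in> carrier G" for x using assms central that by auto
  show "x \<otimes> (e \<otimes> y) = e \<otimes> (x \<otimes> y)" if "x \<in> carrier G" "y \<in> carrier G" for x y
    using that e c by (simp flip: m_assoc)
  show "e \<otimes> (e \<otimes> x) = x" if "x \<in> carrier G" for x
    using that e ee by (simp flip: m_assoc)
qed

lemma sign_mult: "e \<in> {\<one>, z} \<Longrightarrow> e' \<in> {\<one>, z} \<Longrightarrow> e \<otimes> e' \<in> {\<one>, z}"
  using z by auto

lemma subgroup_sign: "subgroup {\<one>, z} G"
proof (rule subgroupI)
  show "inv e \<in> {\<one>, z}" if "e \<in> {\<one>, z}" for e
    using sign_facts(1,2)[OF that] that by (metis inv_equality)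
qed (use z sign_mult in auto)

lemma commute_upto_sym:
  assumes "commute_upto z x y" "x \<in> carrier G" "y \<in> carrier G"
  shows "commute_upto z y x"
proof -
  obtain e where e: "e \<in> {\<one>, z}" "x \<otimes> y = e \<otimes> (y \<otimes> x)"
    using assms(1) by (auto simp: commute_upto_def)
  have "e \<otimes> (e \<otimes> (y \<otimes> x)) = y \<otimes> x"
    by (rule sign_facts(5)[OF e(1)]) (use assms in auto)
  then have "y \<otimes> x = e \<otimes> (x \<otimes> y)" unfolding e(2) by simp
  then show ?thesis using e(1) by (auto simp: commute_upto_def)
qed

lemma subgroup_commute_upto:
  assumes x: "x \<in> carrier G"
  shows "subgroup {y \<in> carrier G. commute_upto z x y} G"
proof (rule subgroupI)
  show "{y \<in> carrier G. commute_upto z x y} \<noteq> {}"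
    using x by (auto simp: commute_upto_def intro!: exI[of _ \<one>])
next
  fix y assume "y \<in> {y \<in> carrier G. commute_upto z x y}"
  then obtain e where y: "y \<in> carrier G" and e: "e \<in> {\<one>, z}" "x \<otimes> y = e \<otimes> (y \<otimes> x)"
    by (auto simp: commute_upto_def)
  note s = sign_facts[OF e(1)]
  have "x \<otimes> inv y = inv y \<otimes> (y \<otimes> x) \<otimes> inv y"
    using x y by (simp flip: m_assoc)
  also have "y \<otimes> x = e \<otimes> (x \<otimes> y)" unfolding e(2) by (rule s(5)[symmetric]) (use x y in auto)
  also have "inv y \<otimes> (e \<otimes> (x \<otimes> y)) \<otimes> inv y = e \<otimes> (inv y \<otimes> x)"
    using x y s(1,3,4) by (simp add: m_assoc)
  finally show "inv y \<in> {y \<in> carrier G. commute_upto z x y}"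
    using y e(1) by (auto simp: commute_upto_def)
next
  fix y y' assume "y \<in> {y \<in> carrier G. commute_upto z x y}" "y' \<in> {y \<in> carrier G. commute_upto z x y}"
  then obtain e e' where y: "y \<in> carrier G" "y' \<in> carrier G" and e: "e \<in> {\<one>, z}" "x \<otimes> y = e \<otimes> (y \<otimes> x)"
    and e': "e' \<in> {\<one>, z}" "x \<otimes> y' = e' \<otimes> (y' \<otimes> x)"
    by (auto simp: commute_upto_def)
  note carr = sign_facts(1)[OF e(1)] sign_facts(1)[OF e'(1)]
  have "x \<otimes> (y \<otimes> y') = (e \<otimes> (y \<otimes> x)) \<otimes> y'"
    using x y e(2) by (simp flip: m_assoc)
  also have "\<dots> = e \<otimes> (y \<otimes> (x \<otimes> y'))"
    using x y carr by (simp add: m_assoc)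
  also have "\<dots> = e \<otimes> (e' \<otimes> (y \<otimes> (y' \<otimes> x)))"
    unfolding e'(2) using x y sign_facts(4)[OF e'(1), of y "y' \<otimes> x"] by simp
  also have "\<dots> = (e \<otimes> e') \<otimes> (y \<otimes> y' \<otimes> x)"
    using x y carr by (simp add: m_assoc)
  finally show "y \<otimes> y' \<in> {y \<in> carrier G. commute_upto z x y}"
    using y sign_mult[OF e(1) e'(1)] by (auto simp: commute_upto_def)
qed auto

lemma commute_upto_generate:
  assumes S: "S \<subseteq> carrier G" "\<And>x y. x \<in> S \<Longrightarrow> y \<in> S \<Longrightarrow> commute_upto z x y"
    and x: "x \<in> generate G S" and y: "y \<in> generate G S"
  shows "commute_upto z x y"
proof -
  have sub: "generate G S \<subseteq> carrier G" by (rule generate_incl) fact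
  have "generate G S \<subseteq> {y \<in> carrier G. commute_upto z x y}" if "x \<in> S" for x
    by (rule generate_subgroup_incl) (use that S subgroup_commute_upto in auto)
  then have "S \<subseteq> {x \<in> carrier G. commute_upto z y x}"
    using S(1) y sub commute_upto_sym by fast
  then have "generate G S \<subseteq> {x \<in> carrier G. commute_upto z y x}"
    by (rule generate_subgroup_incl) (use y sub subgroup_commute_upto in auto)
  then show ?thesis using x y sub commute_upto_sym by fast
qed

text \<open>
  Adjoining an involution \<open>b\<close> that commutes up to \<open>z\<close> with a subgroup \<open>H\<close> containing \<open>z\<close> at most doubles the
  order, as \<open>H \<union> b H\<close> is a subgroup.
\<close>

lemma card_generate_involutions:
  assumes "finite B" "B \<subseteq> carrier G" "\<And>x. x \<in> B \<Longrightarrow> x \<otimes> x = \<one>"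
    "\<And>x y. x \<in> B \<Longrightarrow> y \<in> B \<Longrightarrow> commute_upto z x y"
  shows "finite (generate G (insert z B)) \<and> card (generate G (insert z B)) \<le> 2 ^ Suc (card B)"
  using assms
proof (induction B rule: finite_induct)
  case empty
  have "generate G {z} \<subseteq> {\<one>, z}"
    by (rule generate_subgroup_incl) (use subgroup_sign in auto)
  then show ?case
    using finite_subset card_mono[of "{\<one>, z}" "generate G {z}"] card_insert_le_m1[of 2 "{z}" \<one>] by fastforce
next
  case (insert b B)
  let ?H = "generate G (insert z B)"
  have b: "b \<in> carrier G" "b \<otimes> b = \<one>" and B: "insert z B \<subseteq> carrier G"
    using insert.prems z by auto
  have IH: "finite ?H" "card ?H \<le> 2 ^ Suc (card B)" using insert by auto
  have H: "subgroup ?H G" by (rule generate_is_subgroup) fact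
  note Hc = subgroup.mem_carrier[OF H]
  have zH: "e \<in> ?H" if "e \<in> {\<one>, z}" for e
    using that by (auto intro: generate.intros)
  have comm: "\<exists>e\<in>{\<one>, z}. h \<otimes> b = e \<otimes> (b \<otimes> h)" if "h \<in> ?H" for h
  proof -
    have "commute_upto z h b"
    proof (rule commute_upto_generate[of "insert z (insert b B)"])
      show "insert z (insert b B) \<subseteq> carrier G" using B b by auto
      show "h \<in> generate G (insert z (insert b B))"
        using that mono_generate[of "insert z B" "insert z (insert b B)"] by blast
      show "b \<in> generate G (insert z (insert b B))" by (rule generate.incl) simp
      show "commute_upto z x y" if "x \<in> insert z (insert b B)" "y \<in> insert z (insert b B)" for x y
      proof (cases "x = z \<or> y = z")
        case True
        have xy: "x \<in> carrier G" "y \<in> carrier G" using that B b by auto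
        then have "x \<otimes> y = y \<otimes> x" "y \<otimes> x \<in> carrier G"
          using True central[OF xy(1)] central[OF xy(2)] by auto
        then show ?thesis by (auto simp: commute_upto_def)
      next
        case False
        then show ?thesis using that insert.prems(3) by auto
      qed
    qed
    then show ?thesis by (simp add: commute_upto_def)
  qed
  let ?M = "?H \<union> (\<lambda>h. b \<otimes> h) ` ?H"
  have M1: "h \<otimes> (b \<otimes> h') \<in> ?M" if h: "h \<in> ?H" "h' \<in> ?H" for h h'
  proof -
    obtain e where e: "e \<in> {\<one>, z}" "h \<otimes> b = e \<otimes> (b \<otimes> h)" using comm[OF h(1)] by auto
    note s = sign_facts[OF e(1)]
    have "h \<otimes> (b \<otimes> h') = (h \<otimes> b) \<otimes> h'" using h b Hc by (simp add: m_assoc)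
    also have "\<dots> = e \<otimes> (b \<otimes> (h \<otimes> h'))" unfolding e(2) using h b Hc s(1) by (simp add: m_assoc)
    also have "\<dots> = b \<otimes> (e \<otimes> (h \<otimes> h'))" using h b Hc s(4)[of b "h \<otimes> h'"] by simp
    finally show ?thesis using subgroup.m_closed[OF H] zH[OF e(1)] h by auto
  qed
  have M2: "b \<otimes> h \<otimes> (b \<otimes> h') \<in> ?M" if h: "h \<in> ?H" "h' \<in> ?H" for h h'
  proof -
    have "b \<otimes> h \<otimes> (b \<otimes> h') = b \<otimes> (h \<otimes> (b \<otimes> h'))" using h b Hc by (simp add: m_assoc)
    moreover have "b \<otimes> k \<in> ?M" if k: "k \<in> ?M" for k
    proof -
      have "b \<otimes> (b \<otimes> g) = g" if "g \<in> ?H" for g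
        using that b Hc by (simp flip: m_assoc)
      then show ?thesis using k by auto
    qed
    ultimately show ?thesis using M1[OF h] by simp
  qed
  have "subgroup ?M G"
  proof (rule subgroupI)
    show "?M \<subseteq> carrier G" using Hc b by auto
    show "?M \<noteq> {}" using zH by auto
    fix x y assume x: "x \<in> ?M"
    have inv_b: "inv b = b" using b by (metis inv_equality)
    show "inv x \<in> ?M"
    proof (cases "x \<in> ?H")
      case False
      then obtain h where h: "h \<in> ?H" "x = b \<otimes> h" using x by auto
      then have "inv x = inv h \<otimes> (b \<otimes> \<one>)" using b Hc inv_b by (simp add: inv_mult_group)
      then show ?thesis
        using M1[OF subgroup.m_inv_closed[OF H h(1)], of \<one>] zH by simp
    qed (use subgroup.m_inv_closed[OF H] in auto)
    assume y: "y \<in> ?M"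
    show "x \<otimes> y \<in> ?M"
    proof -
      consider "x \<in> ?H" "y \<in> ?H" | h' where "x \<in> ?H" "h' \<in> ?H" "y = b \<otimes> h'"
        | h where "h \<in> ?H" "x = b \<otimes> h" "y \<in> ?H"
        | h h' where "h \<in> ?H" "x = b \<otimes> h" "h' \<in> ?H" "y = b \<otimes> h'"
        using x y by blast
      then show ?thesis
      proof cases
        case 3
        then have "x \<otimes> y = b \<otimes> (h \<otimes> y)" using b Hc by (simp add: m_assoc)
        then show ?thesis using 3 subgroup.m_closed[OF H] by auto
      qed (use M1 M2 subgroup.m_closed[OF H] in auto)
    qed
  qed
  moreover have "insert z (insert b B) \<subseteq> ?M"
  proof -
    have "b = b \<otimes> \<one>" using b by simp
    then have "b \<in> ?M" using zH[of \<one>] by blast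
    then show ?thesis by (auto intro: generate.intros)
  qed
  ultimately have sub: "generate G (insert z (insert b B)) \<subseteq> ?M"
    by (intro generate_subgroup_incl)
  have "card ?M \<le> card ?H + card ?H"
    using card_Un_le[of ?H "(\<lambda>h. b \<otimes> h) ` ?H"] card_image_le[OF IH(1), of "\<lambda>h. b \<otimes> h"] by linarith
  then have "card ?M \<le> 2 ^ Suc (card (insert b B))"
    using IH(2) insert.hyps by simp
  moreover have "finite ?M" using IH(1) by simp
  ultimately show ?case
    using card_mono[OF _ sub] finite_subset[OF sub] by fastforce
qed

end

end

section \<open>A generating set of binomial size\<close>

text \<open>
  A combinatorial form of the spanning statement: \<open>M i j k l\<close> stands for membership of \<open>(i j k l)\<close> in a
  subgroup that contains the generators attached to the indices. Let \<open>N\<close> be the largest point. For the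
  pentagon on \<open>(N, a, b, 1, d)\<close> two factors are in the basis (up to symmetry) and one does not contain \<open>N\<close>, so
  \<open>(N a b 1)\<close> and \<open>(N a b d)\<close> are members simultaneously. Using this for \<open>(a, d)\<close> and \<open>(d, a)\<close> reaches
  all generators in which \<open>N\<close> is opposite to \<open>b\<close> from a single one.
\<close>

lemma quad_span:
  fixes M :: "nat \<Rightarrow> nat \<Rightarrow> nat \<Rightarrow> nat \<Rightarrow> bool"
  assumes rotate: "\<And>i j k l. \<lbrakk>{i, j, k, l} \<subseteq> {1..n}; distinct [i, j, k, l]\<rbrakk> \<Longrightarrow> M i j k l = M j k l i"
    and reflect: "\<And>i j k l. \<lbrakk>{i, j, k, l} \<subseteq> {1..n}; distinct [i, j, k, l]\<rbrakk> \<Longrightarrow> M i j k l = M i l k j"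
    and pentagon: "\<And>i j k l m. \<lbrakk>{i, j, k, l, m} \<subseteq> {1..n}; distinct [i, j, k, l, m];
      M i j l m; M j k l m; M i k l m\<rbrakk> \<Longrightarrow> M i j k l = M i j k m"
    and basis: "\<And>T. T \<in> indices n \<Longrightarrow> (case basis T of (i, j, k, l) \<Rightarrow> M i j k l)"
    and ijkl: "{i, j, k, l} \<subseteq> {1..n}" "distinct [i, j, k, l]"
  shows "M i j k l"
proof -
  have "\<forall>i j k l. {i, j, k, l} \<subseteq> {1..N} \<longrightarrow> distinct [i, j, k, l] \<longrightarrow> M i j k l" if "N \<le> n" for N
    using that
  proof (induction N)
    case 0
    then show ?case by simp
  next
    case (Suc m)
    define N where "N = Suc m"
    have N: "N \<le> n" "1 \<le> N" using Suc.prems by (auto simp: N_def)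
    have lower: "M i j k l" if "{i, j, k, l} \<subseteq> {1..<N}" "distinct [i, j, k, l]" for i j k l
      using Suc.IH Suc.prems that by (auto simp: N_def)
    have refl: "M N j k l = M N l k j" if "{j, k, l} \<subseteq> {1..<N}" "distinct [j, k, l]" for j k l
      by (rule reflect) (use that N in auto)
    have one_opposite: "M N b 1 d" if bd: "b \<in> {2..<N}" "d \<in> {2..<N}" "b \<noteq> d" for b d
    proof -
      have *: "M N b 1 d" if bd: "b \<in> {2..<N}" "d \<in> {2..<N}" "b < d" for b d
        using basis[of "{b, d, N}"] basis_triple[of b d N] bd N by (auto simp: indices_def)
      show ?thesis
        using *[of b d] *[of d b] refl[of b 1 d] bd by (cases "b < d") auto
    qed
    have step: "M N a b 1 = M N a b d" if "a \<in> {2..<N}" "b \<in> {2..<N}" "d \<in> {2..<N}" "distinct [a, b, d]" for a b d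
    proof (rule pentagon)
      show "M N a 1 d" "M N b 1 d" using that by (simp_all add: one_opposite del: One_nat_def)
      show "M a b 1 d" by (rule lower) (use that in auto)
    qed (use that N in auto)
    have one_adjacent: "M N a b 1" if ab: "a \<in> {2..<N}" "b \<in> {2..<N}" "a \<noteq> b" for a b
    proof -
      define c :: nat where "c = (if b = 2 then 3 else 2)"
      have c: "c \<in> {2..<N}" "c \<noteq> b" using ab by (auto simp: c_def)
      have "{b, N} \<in> indices n" using ab N by (auto simp: indices_def doubleton_eq_iff)
      from basis[OF this] have "M N 1 b c"
        using basis_pair[of b N] ab by (simp add: c_def)
      then have start: "M N c b 1" using refl[of 1 b c] c ab by auto
      show ?thesis
      proof (cases "a = c")
        case False
        then have "M N c b a" using step[of c b a] start ab c by auto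
        then have "M N a b c" using refl[of c b a] ab c False by auto
        then show ?thesis using step[of a b c] ab c False by auto
      qed (use start in simp)
    qed
    have first: "M N j k l" if jkl: "{j, k, l} \<subseteq> {1..<N}" "distinct [j, k, l]" for j k l
    proof -
      consider "k = 1" | "l = 1" | "j = 1" | "j \<noteq> 1" "k \<noteq> 1" "l \<noteq> 1" by blast
      then show ?thesis
      proof cases
        case 3
        then show ?thesis using refl[of j k l] one_adjacent[of l k] jkl by auto
      next
        case 4
        then show ?thesis using step[of j k l] one_adjacent[of j k] jkl by auto
      qed (use one_opposite[of j l] one_adjacent[of j k] jkl in auto)
    qed
    show ?case
    proof (intro allI impI)
      fix i j k l assume ijkl: "{i, j, k, l} \<subseteq> {1..Suc m}" "distinct [i, j, k, l]"
      have sub: "{i, j, k, l} \<subseteq> {1..n}" using ijkl(1) Suc.prems by auto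
      have rot: "M i j k l = M j k l i" "M j k l i = M k l i j" "M k l i j = M l i j k"
        by (rule rotate; use sub ijkl(2) in auto)+
      consider "N \<notin> {i, j, k, l}" | "i = N" | "j = N" | "k = N" | "l = N" by blast
      then show "M i j k l"
      proof cases
        case 1
        then have "{i, j, k, l} \<subseteq> {1..<N}" using ijkl(1) by (force simp: N_def)
        then show ?thesis using lower ijkl(2) by blast
      next
        case 2
        have "{j, k, l} \<subseteq> {1..<N}" using 2 ijkl by (force simp: N_def)
        then show ?thesis using first[of j k l] 2 ijkl(2) by auto
      next
        case 3
        have "{k, l, i} \<subseteq> {1..<N}" using 3 ijkl by (force simp: N_def)
        then show ?thesis using first[of k l i] 3 ijkl(2) rot by auto
      next
        case 4
        have "{l, i, j} \<subseteq> {1..<N}" using 4 ijkl by (force simp: N_def)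
        then show ?thesis using first[of l i j] 4 ijkl(2) rot by auto
      next
        case 5
        have "{i, j, k} \<subseteq> {1..<N}" using 5 ijkl by (force simp: N_def)
        then show ?thesis using first[of i j k] 5 ijkl(2) rot by auto
      qed
    qed
  qed
  from this[OF order.refl] show ?thesis using ijkl by blast
qed

section \<open>The generators act by left multiplication\<close>

text \<open>
  The element of \<open>\<Gamma>\<close> represented by a word.
\<close>

definition word_class :: "nat \<Rightarrow> quad word \<Rightarrow> quad word set" where
  "word_class n w = pres_cong (gamma4_gens n) (gamma4_rels n) `` {w}"

text \<open>
  A generator as an element of \<open>\<Gamma>\<close>.
\<close>

definition gen :: "nat \<Rightarrow> quad \<Rightarrow> quad word set" where
  "gen n q = word_class n [(q, True)]"

lemma group_Gamma4: "group (Gamma4 n)"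
  unfolding Gamma4_def by (rule group_presented_group)

lemma word_class_in: "w \<in> words (gamma4_gens n) \<Longrightarrow> word_class n w \<in> carrier (Gamma4 n)"
  by (simp add: word_class_def Gamma4_def presented_group_def quotientI)

lemma word_class_ex: "A \<in> carrier (Gamma4 n) \<Longrightarrow> \<exists>w\<in>words (gamma4_gens n). A = word_class n w"
  by (auto simp: word_class_def Gamma4_def presented_group_def elim: quotientE)

lemma word_class_mult:
  "u \<in> words (gamma4_gens n) \<Longrightarrow> v \<in> words (gamma4_gens n) \<Longrightarrow>
    word_class n u \<otimes>\<^bsub>Gamma4 n\<^esub> word_class n v = word_class n (u @ v)"
  by (simp add: word_class_def Gamma4_def presented_group_mult)

lemma word_class_Nil: "word_class n [] = \<one>\<^bsub>Gamma4 n\<^esub>"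
  by (simp add: word_class_def Gamma4_def presented_group_def)

lemma word_class_eq:
  "(u, v) \<in> pres_cong (gamma4_gens n) (gamma4_rels n) \<Longrightarrow> word_class n u = word_class n v"
  unfolding word_class_def by (rule equiv_class_eq[OF equiv_pres_cong])

lemma gen_in: "q \<in> gamma4_gens n \<Longrightarrow> gen n q \<in> carrier (Gamma4 n)"
  unfolding gen_def by (rule word_class_in) (simp add: words_def)

lemma gen_mult:
  "q \<in> gamma4_gens n \<Longrightarrow> w \<in> words (gamma4_gens n) \<Longrightarrow>
    gen n q \<otimes>\<^bsub>Gamma4 n\<^esub> word_class n w = word_class n ((q, True) # w)"
  unfolding gen_def by (subst word_class_mult) (simp_all add: words_def)

lemma relation_prefix:
  assumes "(u, v) \<in> gamma4_rels n" "u \<in> words (gamma4_gens n)" "v \<in> words (gamma4_gens n)"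
    "w \<in> words (gamma4_gens n)"
  shows "word_class n (u @ w) = word_class n (v @ w)"
  by (rule word_class_eq, rule pres_cong.append[OF pres_cong.rel[OF assms(1-3)] pres_cong.refl[OF assms(4)]])

lemma generate_gens: "generate (Gamma4 n) (gen n ` gamma4_gens n) = carrier (Gamma4 n)"
proof
  interpret group "Gamma4 n" by (rule group_Gamma4)
  show "generate (Gamma4 n) (gen n ` gamma4_gens n) \<subseteq> carrier (Gamma4 n)"
    by (rule generate_incl) (auto simp: gen_in)
  show "carrier (Gamma4 n) \<subseteq> generate (Gamma4 n) (gen n ` gamma4_gens n)"
  proof
    fix A assume "A \<in> carrier (Gamma4 n)"
    then obtain w where w: "w \<in> words (gamma4_gens n)" "A = word_class n w" using word_class_ex by blast
    have "word_class n w \<in> generate (Gamma4 n) (gen n ` gamma4_gens n)" using w(1)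
    proof (induction w)
      case Nil
      then show ?case by (simp add: word_class_Nil generate.one)
    next
      case (Cons x w)
      obtain q b where x: "x = (q, b)" by (cases x) auto
      have q: "q \<in> gamma4_gens n" and w: "w \<in> words (gamma4_gens n)"
        using Cons.prems x by (auto simp: words_def)
      have "word_class n [(q, False)] = inv\<^bsub>Gamma4 n\<^esub> gen n q"
      proof (rule inv_equality[symmetric])
        have c: "([(q, False), (q, True)], []) \<in> pres_cong (gamma4_gens n) (gamma4_rels n)"
          using pres_cong.cancel[OF q, of False] by simp
        show "word_class n [(q, False)] \<otimes>\<^bsub>Gamma4 n\<^esub> gen n q = \<one>\<^bsub>Gamma4 n\<^esub>"
          using q word_class_eq[OF c] unfolding gen_def
          by (subst word_class_mult) (simp_all add: words_def word_class_Nil[symmetric])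
      qed (use q gen_in in \<open>auto simp: words_def intro!: word_class_in\<close>)
      then have "word_class n [(q, b)] \<in> generate (Gamma4 n) (gen n ` gamma4_gens n)"
        using q by (cases b) (auto simp: gen_def[symmetric] intro: generate.incl generate.inv)
      moreover have "word_class n (x # w) = word_class n [(q, b)] \<otimes>\<^bsub>Gamma4 n\<^esub> word_class n w"
        using q w x by (subst word_class_mult) (auto simp: words_def)
      ultimately show ?case using Cons.IH[OF w] by (auto intro: generate.eng)
    qed
    then show "A \<in> generate (Gamma4 n) (gen n ` gamma4_gens n)" using w(2) by simp
  qed
qed

text \<open>
  Left multiplication by a generator, extended by the identity outside the carrier so that the relations
  hold at every point of the type.
\<close>

definition left_mult :: "nat \<Rightarrow> nat \<Rightarrow> nat \<Rightarrow> nat \<Rightarrow> nat \<Rightarrow> quad word set \<Rightarrow> quad word set" where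
  "left_mult n i j k l y =
    (if y \<in> carrier (Gamma4 n) then gen n (i, j, k, l) \<otimes>\<^bsub>Gamma4 n\<^esub> y else y)"

lemma left_mult_word_class:
  "{i, j, k, l} \<subseteq> {1..n} \<Longrightarrow> distinct [i, j, k, l] \<Longrightarrow> w \<in> words (gamma4_gens n) \<Longrightarrow>
    left_mult n i j k l (word_class n w) = word_class n (qgen i j k l # w)"
  by (simp add: left_mult_def word_class_in gen_mult gamma4_gens_def)

lemma Cons_in_words:
  "{i, j, k, l} \<subseteq> {1..n} \<Longrightarrow> distinct [i, j, k, l] \<Longrightarrow>
    (((i, j, k, l), b) # w \<in> words (gamma4_gens n)) = (w \<in> words (gamma4_gens n))"
  by (auto simp: words_def gamma4_gens_def)

lemma gamma4_rels_I:
  "(i, j, k, l) \<in> gamma4_gens n \<Longrightarrow> ([qgen i j k l, qgen i j k l], []) \<in> gamma4_rels n"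
  "(i, j, k, l) \<in> gamma4_gens n \<Longrightarrow> (s, t, u, v) \<in> gamma4_gens n \<Longrightarrow>
    card ({i, j, k, l} \<inter> {s, t, u, v}) \<le> 2 \<Longrightarrow>
    ([qgen i j k l, qgen s t u v], [qgen s t u v, qgen i j k l]) \<in> gamma4_rels n"
  "{i, j, k, l, m} \<subseteq> {1..n} \<Longrightarrow> distinct [i, j, k, l, m] \<Longrightarrow>
    ([qgen i j k l, qgen i j l m, qgen j k l m, qgen i j k m, qgen i k l m], []) \<in> gamma4_rels n"
  "(i, j, k, l) \<in> gamma4_gens n \<Longrightarrow> ([qgen i j k l], [qgen j k l i]) \<in> gamma4_rels n"
  "(i, j, k, l) \<in> gamma4_gens n \<Longrightarrow> ([qgen j k l i], [qgen l k j i]) \<in> gamma4_rels n"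
  by (simp_all add: gamma4_rels_def)

lemma quad_action_Gamma4:
  assumes "6 \<le> n"
  shows "quad_action n (left_mult n)"
proof
  note LM = left_mult_word_class Cons_in_words
  have outside: "left_mult n i j k l y = y" if "y \<notin> carrier (Gamma4 n)" for i j k l y
    using that by (simp add: left_mult_def)
  show "6 \<le> n" by fact
  fix i j k l :: nat and y
  assume ijkl: "{i, j, k, l} \<subseteq> {1..n}" "distinct [i, j, k, l]"
  then have g: "(i, j, k, l) \<in> gamma4_gens n" by (simp add: gamma4_gens_def)
  have perm: "{j, k, l, i} \<subseteq> {1..n}" "distinct [j, k, l, i]" "{l, k, j, i} \<subseteq> {1..n}" "distinct [l, k, j, i]"
    using ijkl by auto
  note L = LM[OF ijkl] LM[OF perm(1,2)] LM[OF perm(3,4)]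
  have rel: "word_class n (u @ w) = word_class n (v @ w)"
    if "(u, v) \<in> gamma4_rels n" "u \<in> words (gamma4_gens n)" "v \<in> words (gamma4_gens n)" "w \<in> words (gamma4_gens n)"
    for u v w using relation_prefix that by blast
  have nil: "[] \<in> words (gamma4_gens n)" by (simp add: words_def)
  show "left_mult n i j k l (left_mult n i j k l y) = y"
  proof (cases "y \<in> carrier (Gamma4 n)")
    case True
    then obtain w where w: "w \<in> words (gamma4_gens n)" "y = word_class n w" using word_class_ex by blast
    have "([qgen i j k l, qgen i j k l], []) \<in> gamma4_rels n"
      by (rule gamma4_rels_I) (fact g)
    from rel[OF this _ _ w(1)] show ?thesis using w nil by (simp add: L)
  qed (simp add: outside)
  show "left_mult n i j k l = left_mult n j k l i"
  proof
    fix y show "left_mult n i j k l y = left_mult n j k l i y"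
    proof (cases "y \<in> carrier (Gamma4 n)")
      case True
      then obtain w where w: "w \<in> words (gamma4_gens n)" "y = word_class n w" using word_class_ex by blast
      have "([qgen i j k l], [qgen j k l i]) \<in> gamma4_rels n"
        by (rule gamma4_rels_I) (fact g)
      from rel[OF this _ _ w(1)] show ?thesis using w nil by (simp add: L)
    qed (simp add: outside)
  qed
  show "left_mult n j k l i = left_mult n l k j i"
  proof
    fix y show "left_mult n j k l i y = left_mult n l k j i y"
    proof (cases "y \<in> carrier (Gamma4 n)")
      case True
      then obtain w where w: "w \<in> words (gamma4_gens n)" "y = word_class n w" using word_class_ex by blast
      have "([qgen j k l i], [qgen l k j i]) \<in> gamma4_rels n"
        by (rule gamma4_rels_I) (fact g)
      from rel[OF this _ _ w(1)] show ?thesis using w nil by (simp add: L)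
    qed (simp add: outside)
  qed
  show "left_mult n i j k l (left_mult n s t u v y) = left_mult n s t u v (left_mult n i j k l y)"
    if stuv: "{s, t, u, v} \<subseteq> {1..n}" "distinct [s, t, u, v]" and "card ({i, j, k, l} \<inter> {s, t, u, v}) \<le> 2"
    for s t u v
  proof (cases "y \<in> carrier (Gamma4 n)")
    case True
    then obtain w where w: "w \<in> words (gamma4_gens n)" "y = word_class n w" using word_class_ex by blast
    have "(s, t, u, v) \<in> gamma4_gens n" using stuv by (simp add: gamma4_gens_def)
    then have "([qgen i j k l, qgen s t u v], [qgen s t u v, qgen i j k l]) \<in> gamma4_rels n"
      by (rule gamma4_rels_I(2)[OF g]) (fact that(3))
    from rel[OF this _ _ w(1)] show ?thesis using w nil by (simp add: L LM[OF stuv])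
  qed (simp add: outside)
next
  fix i j k l m :: nat and y
  assume ijklm: "{i, j, k, l, m} \<subseteq> {1..n}" "distinct [i, j, k, l, m]"
  have sub: "{i, j, k, l} \<subseteq> {1..n}" "distinct [i, j, k, l]" "{i, j, l, m} \<subseteq> {1..n}" "distinct [i, j, l, m]"
    "{j, k, l, m} \<subseteq> {1..n}" "distinct [j, k, l, m]" "{i, j, k, m} \<subseteq> {1..n}" "distinct [i, j, k, m]"
    "{i, k, l, m} \<subseteq> {1..n}" "distinct [i, k, l, m]"
    using ijklm by auto
  note LM = left_mult_word_class Cons_in_words
  note L = LM[OF sub(1,2)] LM[OF sub(3,4)] LM[OF sub(5,6)] LM[OF sub(7,8)] LM[OF sub(9,10)]
  show "left_mult n i j k l (left_mult n i j l m (left_mult n j k l m (left_mult n i j k m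
    (left_mult n i k l m y)))) = y"
  proof (cases "y \<in> carrier (Gamma4 n)")
    case True
    then obtain w where w: "w \<in> words (gamma4_gens n)" "y = word_class n w" using word_class_ex by blast
    have "([qgen i j k l, qgen i j l m, qgen j k l m, qgen i j k m, qgen i k l m], []) \<in> gamma4_rels n"
      by (rule gamma4_rels_I; fact ijklm)
    from relation_prefix[OF this _ _ w(1)] show ?thesis
      using w by (simp add: L words_def[of "gamma4_gens n", THEN eq_refl, THEN subsetD, of "[]"]) (simp add: words_def)
  qed (simp add: left_mult_def)
qed

section \<open>Structure of the group\<close>

context
  fixes n :: nat
  assumes n: "6 \<le> n"
begin

interpretation quad_action n "left_mult n" by (rule quad_action_Gamma4[OF n])

interpretation group "Gamma4 n" by (rule group_Gamma4)

text \<open>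
  The nontrivial element of the derived subgroup.
\<close>

definition zeta :: "quad word set" where
  "zeta = Z \<one>\<^bsub>Gamma4 n\<^esub>"

lemma left_mult_in: "y \<in> carrier (Gamma4 n) \<Longrightarrow> {i, j, k, l} \<subseteq> {1..n} \<Longrightarrow> distinct [i, j, k, l] \<Longrightarrow>
    left_mult n i j k l y = gen n (i, j, k, l) \<otimes>\<^bsub>Gamma4 n\<^esub> y"
  by (simp add: left_mult_def)

lemma small_gens: "gen n (1, 2, 3, 4) \<in> carrier (Gamma4 n)" "gen n (1, 2, 3, 5) \<in> carrier (Gamma4 n)"
  using n by (auto intro!: gen_in simp: gamma4_gens_def)

lemma zeta_eq: "zeta = gen n (1, 2, 3, 4) \<otimes>\<^bsub>Gamma4 n\<^esub> (gen n (1, 2, 3, 5) \<otimes>\<^bsub>Gamma4 n\<^esub>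
   (gen n (1, 2, 3, 4) \<otimes>\<^bsub>Gamma4 n\<^esub> gen n (1, 2, 3, 5)))"
  using n small_gens unfolding zeta_def Z_commutator by (simp add: left_mult_def)

lemma Z_eq: "y \<in> carrier (Gamma4 n) \<Longrightarrow> Z y = zeta \<otimes>\<^bsub>Gamma4 n\<^esub> y"
  using n small_gens unfolding zeta_eq Z_commutator by (simp add: left_mult_def m_assoc)

lemma zeta_in: "zeta \<in> carrier (Gamma4 n)"
  unfolding zeta_eq using small_gens by simp

lemma zeta_square: "zeta \<otimes>\<^bsub>Gamma4 n\<^esub> zeta = \<one>\<^bsub>Gamma4 n\<^esub>"
  using Z_square[of "\<one>\<^bsub>Gamma4 n\<^esub>"] zeta_in by (simp add: Z_eq)

lemma gens_cases:
  assumes "x \<in> gen n ` gamma4_gens n"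
  obtains i j k l where "x = gen n (i, j, k, l)" "{i, j, k, l} \<subseteq> {1..n}" "distinct [i, j, k, l]"
  using assms unfolding gamma4_gens_def by blast

lemma gens_subset: "gen n ` gamma4_gens n \<subseteq> carrier (Gamma4 n)"
  by (auto simp: gen_in)

lemma zeta_central:
  assumes "x \<in> carrier (Gamma4 n)"
  shows "x \<otimes>\<^bsub>Gamma4 n\<^esub> zeta = zeta \<otimes>\<^bsub>Gamma4 n\<^esub> x"
proof -
  have gens: "x \<otimes>\<^bsub>Gamma4 n\<^esub> zeta = zeta \<otimes>\<^bsub>Gamma4 n\<^esub> x" if "x \<in> gen n ` gamma4_gens n" for x
    using that
  proof (rule gens_cases)
    fix i j k l assume x: "x = gen n (i, j, k, l)" and ijkl: "{i, j, k, l} \<subseteq> {1..n}" "distinct [i, j, k, l]"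
    have xc: "x \<in> carrier (Gamma4 n)" using that gens_subset by blast
    have "left_mult n i j k l (Z \<one>\<^bsub>Gamma4 n\<^esub>) = Z (left_mult n i j k l \<one>\<^bsub>Gamma4 n\<^esub>)"
      by (rule Z_commute[OF Q_I[OF HOL.refl ijkl(2)] ijkl(1)])
    then show ?thesis
      using xc zeta_in ijkl by (simp add: Z_eq left_mult_in x[symmetric])
  qed
  show ?thesis
    using assms unfolding generate_gens[symmetric]
  proof (induction rule: generate.induct)
    case (inv h)
    have h: "h \<in> carrier (Gamma4 n)" using inv gens_subset by blast
    have "inv\<^bsub>Gamma4 n\<^esub> h \<otimes>\<^bsub>Gamma4 n\<^esub> zeta = inv\<^bsub>Gamma4 n\<^esub> h \<otimes>\<^bsub>Gamma4 n\<^esub> (zeta \<otimes>\<^bsub>Gamma4 n\<^esub> h) \<otimes>\<^bsub>Gamma4 n\<^esub> inv\<^bsub>Gamma4 n\<^esub> h"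
      using h zeta_in by (simp add: m_assoc)
    also have "zeta \<otimes>\<^bsub>Gamma4 n\<^esub> h = h \<otimes>\<^bsub>Gamma4 n\<^esub> zeta" using gens[OF inv] by simp
    finally show ?case using h zeta_in by (simp flip: m_assoc)
  next
    case (eng h1 h2)
    have h: "h1 \<in> carrier (Gamma4 n)" "h2 \<in> carrier (Gamma4 n)"
      using eng generate_gens by blast+
    then show ?case using eng.IH zeta_in by (metis m_assoc)
  qed (use gens zeta_in in auto)
qed

lemma gens_square: "x \<in> gen n ` gamma4_gens n \<Longrightarrow> x \<otimes>\<^bsub>Gamma4 n\<^esub> x = \<one>\<^bsub>Gamma4 n\<^esub>"
proof (erule gens_cases)
  fix i j k l assume x: "x = gen n (i, j, k, l)" and ijkl: "{i, j, k, l} \<subseteq> {1..n}" "distinct [i, j, k, l]"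
  have "x \<in> carrier (Gamma4 n)" unfolding x by (rule gen_in) (use ijkl in \<open>simp add: gamma4_gens_def\<close>)
  then show "x \<otimes>\<^bsub>Gamma4 n\<^esub> x = \<one>\<^bsub>Gamma4 n\<^esub>"
    using square[OF ijkl, of "\<one>\<^bsub>Gamma4 n\<^esub>"] ijkl by (simp add: left_mult_in x[symmetric])
qed

lemma gens_commute:
  assumes x: "x \<in> gen n ` gamma4_gens n" and y: "y \<in> gen n ` gamma4_gens n"
  shows "commute_upto zeta x y"
  using x
proof (rule gens_cases)
  fix i j k l assume x': "x = gen n (i, j, k, l)" and ijkl: "{i, j, k, l} \<subseteq> {1..n}" "distinct [i, j, k, l]"
  show ?thesis using y
  proof (rule gens_cases)
    fix s t u v assume y': "y = gen n (s, t, u, v)" and stuv: "{s, t, u, v} \<subseteq> {1..n}" "distinct [s, t, u, v]"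
    have c: "x \<in> carrier (Gamma4 n)" "y \<in> carrier (Gamma4 n)" using x y gens_subset by blast+
    let ?c = "card ({i, j, k, l} \<inter> {s, t, u, v}) = 3"
    have "left_mult n i j k l (left_mult n s t u v \<one>\<^bsub>Gamma4 n\<^esub>) =
       (if ?c then Z (left_mult n s t u v (left_mult n i j k l \<one>\<^bsub>Gamma4 n\<^esub>))
        else left_mult n s t u v (left_mult n i j k l \<one>\<^bsub>Gamma4 n\<^esub>))"
      by (rule Q_swap[OF Q_I[OF HOL.refl ijkl(2)] ijkl(1) Q_I[OF HOL.refl stuv(2)] stuv(1)])
    then have "x \<otimes>\<^bsub>Gamma4 n\<^esub> y = (if ?c then zeta else \<one>\<^bsub>Gamma4 n\<^esub>) \<otimes>\<^bsub>Gamma4 n\<^esub> (y \<otimes>\<^bsub>Gamma4 n\<^esub> x)"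
      using c ijkl stuv by (simp add: Z_eq left_mult_in x'[symmetric] y'[symmetric])
    then show ?thesis unfolding commute_upto_def by (cases ?c) simp_all
  qed
qed

lemma generate_basis:
  "generate (Gamma4 n) (insert zeta ((\<lambda>T. gen n (basis T)) ` indices n)) = carrier (Gamma4 n)"
  (is "generate _ ?B = _")
proof
  have B: "?B \<subseteq> carrier (Gamma4 n)"
    using zeta_in by (auto intro: gen_in[OF basis_in_gens])
  then show "generate (Gamma4 n) ?B \<subseteq> carrier (Gamma4 n)" by (rule generate_incl)
  let ?H = "generate (Gamma4 n) ?B"
  have H: "subgroup ?H (Gamma4 n)" by (rule generate_is_subgroup) fact
  have c: "gen n (i, j, k, l) \<in> carrier (Gamma4 n)" if "{i, j, k, l} \<subseteq> {1..n}" "distinct [i, j, k, l]" for i j k l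
    using that by (simp add: gen_in gamma4_gens_def)
  have eq: "gen n (i, j, k, l) = left_mult n i j k l \<one>\<^bsub>Gamma4 n\<^esub>"
    if "{i, j, k, l} \<subseteq> {1..n}" "distinct [i, j, k, l]" for i j k l
    using c[OF that] by (simp add: left_mult_def)
  have "gen n (i, j, k, l) \<in> ?H" if "{i, j, k, l} \<subseteq> {1..n}" "distinct [i, j, k, l]" for i j k l
    using that
  proof (rule quad_span[rotated -2])
    fix i j k l assume ijkl: "{i, j, k, l} \<subseteq> {1..n}" "distinct [i, j, k, l]"
    then have perm: "{j, k, l, i} \<subseteq> {1..n}" "distinct [j, k, l, i]" "{i, l, k, j} \<subseteq> {1..n}" "distinct [i, l, k, j]"
      by auto
    show "(gen n (i, j, k, l) \<in> ?H) = (gen n (j, k, l, i) \<in> ?H)"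
      using eq[OF ijkl] eq[OF perm(1,2)] rotate[OF ijkl] by simp
    show "(gen n (i, j, k, l) \<in> ?H) = (gen n (i, l, k, j) \<in> ?H)"
      using eq[OF ijkl] eq[OF perm(3,4)] reflect'[OF ijkl] by simp
  next
    fix i j k l m assume ijklm: "{i, j, k, l, m} \<subseteq> {1..n}" "distinct [i, j, k, l, m]"
      and mem: "gen n (i, j, l, m) \<in> ?H" "gen n (j, k, l, m) \<in> ?H" "gen n (i, k, l, m) \<in> ?H"
    let ?a = "gen n (i, j, k, l)" and ?b = "gen n (i, j, l, m)" and ?c = "gen n (j, k, l, m)"
      and ?d = "gen n (i, j, k, m)" and ?e = "gen n (i, k, l, m)"
    have carr: "?a \<in> carrier (Gamma4 n)" "?b \<in> carrier (Gamma4 n)" "?c \<in> carrier (Gamma4 n)"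
      "?d \<in> carrier (Gamma4 n)" "?e \<in> carrier (Gamma4 n)"
      by (rule c; use ijklm in auto)+
    have "left_mult n i j k l (left_mult n i j l m (left_mult n j k l m (left_mult n i j k m
      (left_mult n i k l m \<one>\<^bsub>Gamma4 n\<^esub>)))) = \<one>\<^bsub>Gamma4 n\<^esub>"
      by (rule pentagon) fact+
    then have "?a \<otimes>\<^bsub>Gamma4 n\<^esub> (?b \<otimes>\<^bsub>Gamma4 n\<^esub> (?c \<otimes>\<^bsub>Gamma4 n\<^esub> (?d \<otimes>\<^bsub>Gamma4 n\<^esub> ?e))) = \<one>\<^bsub>Gamma4 n\<^esub>"
      using carr by (simp add: left_mult_def)
    then have p: "(?a \<otimes>\<^bsub>Gamma4 n\<^esub> (?b \<otimes>\<^bsub>Gamma4 n\<^esub> ?c)) \<otimes>\<^bsub>Gamma4 n\<^esub> (?d \<otimes>\<^bsub>Gamma4 n\<^esub> ?e) = \<one>\<^bsub>Gamma4 n\<^esub>"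
      using carr by (simp add: m_assoc)
    have bc: "?b \<otimes>\<^bsub>Gamma4 n\<^esub> ?c \<in> ?H" using subgroup.m_closed[OF H] mem by blast
    have cancel_right: "x \<in> ?H" if "x \<otimes>\<^bsub>Gamma4 n\<^esub> y \<in> ?H" "y \<in> ?H" "x \<in> carrier (Gamma4 n)" for x y
    proof -
      have "y \<in> carrier (Gamma4 n)" using that(2) subgroup.mem_carrier[OF H] by blast
      then have "x = (x \<otimes>\<^bsub>Gamma4 n\<^esub> y) \<otimes>\<^bsub>Gamma4 n\<^esub> inv\<^bsub>Gamma4 n\<^esub> y" using that(3) by (simp add: m_assoc)
      then show ?thesis using subgroup.m_closed[OF H] subgroup.m_inv_closed[OF H] that(1,2) by metis
    qed
    have iff: "x \<in> ?H \<longleftrightarrow> y \<in> ?H" if "x \<otimes>\<^bsub>Gamma4 n\<^esub> y = \<one>\<^bsub>Gamma4 n\<^esub>" "x \<in> carrier (Gamma4 n)" "y \<in> carrier (Gamma4 n)" for x y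
    proof -
      have "x = inv\<^bsub>Gamma4 n\<^esub> y" "y = inv\<^bsub>Gamma4 n\<^esub> x"
        using that inv_equality[of x y] by auto
      then show ?thesis using subgroup.m_inv_closed[OF H] by metis
    qed
    have "?a \<in> ?H \<longleftrightarrow> ?a \<otimes>\<^bsub>Gamma4 n\<^esub> (?b \<otimes>\<^bsub>Gamma4 n\<^esub> ?c) \<in> ?H"
      using cancel_right[OF _ bc carr(1)] subgroup.m_closed[OF H _ bc] by blast
    \<comment> \<open>The pentagon cut in two: both parts are inverse to each other.\<close>
    also have "\<dots> \<longleftrightarrow> ?d \<otimes>\<^bsub>Gamma4 n\<^esub> ?e \<in> ?H"
      by (rule iff[OF p]) (use carr in auto)
    also have "\<dots> \<longleftrightarrow> ?d \<in> ?H"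
      using cancel_right[OF _ mem(3) carr(4)] subgroup.m_closed[OF H _ mem(3)] by blast
    finally show "(?a \<in> ?H) = (?d \<in> ?H)" .
  next
    fix T assume "T \<in> indices n"
    then have "gen n (basis T) \<in> ?H" by (auto intro: generate.incl)
    then show "case basis T of (i, j, k, l) \<Rightarrow> gen n (i, j, k, l) \<in> ?H" by (auto split: prod.split)
  qed
  then have "gen n ` gamma4_gens n \<subseteq> ?H"
    by (auto simp: gamma4_gens_def)
  then show "carrier (Gamma4 n) \<subseteq> ?H"
    unfolding generate_gens[symmetric] by (rule generate_subgroup_incl) (fact H)
qed

lemma order_Gamma4: "finite (carrier (Gamma4 n))" "card (carrier (Gamma4 n)) = 2 ^ (n choose 3)"
proof -
  let ?B = "(\<lambda>T. gen n (basis T)) ` indices n"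
  have B: "?B \<subseteq> gen n ` gamma4_gens n" using basis_in_gens by auto
  have *: "finite (generate (Gamma4 n) (insert zeta ?B)) \<and>
      card (generate (Gamma4 n) (insert zeta ?B)) \<le> 2 ^ Suc (card ?B)"
  proof (rule card_generate_involutions[OF zeta_in zeta_square zeta_central])
    show "finite ?B" by (simp add: finite_indices)
    show "?B \<subseteq> carrier (Gamma4 n)" using B gens_subset by blast
    show "x \<otimes>\<^bsub>Gamma4 n\<^esub> x = \<one>\<^bsub>Gamma4 n\<^esub>" if "x \<in> ?B" for x
      by (rule gens_square[OF subsetD[OF B that]])
    show "commute_upto zeta x y" if "x \<in> ?B" "y \<in> ?B" for x y
      by (rule gens_commute[OF subsetD[OF B that(1)] subsetD[OF B that(2)]])
  qed
  then show fin: "finite (carrier (Gamma4 n))" by (simp add: generate_basis)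
  have "card (carrier (Gamma4 n)) \<le> 2 ^ Suc (card ?B)" using * by (simp add: generate_basis)
  also have "\<dots> \<le> 2 ^ Suc (card (indices n))"
    using card_image_le[OF finite_indices] by (intro power_increasing) auto
  also have "\<dots> = 2 ^ (n choose 3)" using card_indices n by simp
  finally show "card (carrier (Gamma4 n)) = 2 ^ (n choose 3)"
    using order_Gamma4_ge[OF _ fin] n by simp
qed

lemma zeta_ne_one: "zeta \<noteq> \<one>\<^bsub>Gamma4 n\<^esub>"
proof
  assume *: "zeta = \<one>\<^bsub>Gamma4 n\<^esub>"
  have g: "(1, 2, 3, 4) \<in> gamma4_gens n" "(1, 2, 3, 5) \<in> gamma4_gens n"
    using n by (auto simp: gamma4_gens_def)
  then have "zeta = word_class n sign_word"
    unfolding zeta_eq sign_word_def gen_def by (simp add: word_class_mult words_def)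
  then have "word_class n sign_word = word_class n []" using * by (simp add: word_class_Nil)
  moreover have "[] \<in> words (gamma4_gens n)" by (simp add: words_def)
  ultimately have "(sign_word, []) \<in> pres_cong (gamma4_gens n) (gamma4_rels n)"
    unfolding word_class_def by (metis eq_equiv_class equiv_pres_cong)
  from quad_flip_pres_cong[OF this, of "({}, False)"] show False
    by (simp add: sign_word_neg)
qed

lemma all_commute_upto:
  assumes "x \<in> carrier (Gamma4 n)" "y \<in> carrier (Gamma4 n)"
  shows "commute_upto zeta x y"
  by (rule commute_upto_generate[OF zeta_in zeta_square zeta_central gens_subset gens_commute])
    (use assms generate_gens in auto)

lemma derived_Gamma4: "derived (Gamma4 n) (carrier (Gamma4 n)) = {\<one>\<^bsub>Gamma4 n\<^esub>, zeta}"
proof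
  have "x \<otimes>\<^bsub>Gamma4 n\<^esub> y \<otimes>\<^bsub>Gamma4 n\<^esub> inv\<^bsub>Gamma4 n\<^esub> x \<otimes>\<^bsub>Gamma4 n\<^esub> inv\<^bsub>Gamma4 n\<^esub> y \<in> {\<one>\<^bsub>Gamma4 n\<^esub>, zeta}"
    if xy: "x \<in> carrier (Gamma4 n)" "y \<in> carrier (Gamma4 n)" for x y
  proof -
    obtain e where e: "e \<in> {\<one>\<^bsub>Gamma4 n\<^esub>, zeta}" "x \<otimes>\<^bsub>Gamma4 n\<^esub> y = e \<otimes>\<^bsub>Gamma4 n\<^esub> (y \<otimes>\<^bsub>Gamma4 n\<^esub> x)"
      using all_commute_upto[OF xy] by (auto simp: commute_upto_def)
    have ec: "e \<in> carrier (Gamma4 n)" using e(1) zeta_in by auto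
    have "x \<otimes>\<^bsub>Gamma4 n\<^esub> y \<otimes>\<^bsub>Gamma4 n\<^esub> inv\<^bsub>Gamma4 n\<^esub> x \<otimes>\<^bsub>Gamma4 n\<^esub> inv\<^bsub>Gamma4 n\<^esub> y = e"
      unfolding e(2) using xy ec by (simp add: m_assoc inv_solve_right)
    then show ?thesis using e(1) by simp
  qed
  then show "derived (Gamma4 n) (carrier (Gamma4 n)) \<subseteq> {\<one>\<^bsub>Gamma4 n\<^esub>, zeta}"
    unfolding derived_def
    by (intro generate_subgroup_incl subgroup_sign[OF zeta_in zeta_square zeta_central]) auto
  let ?a = "gen n (1, 2, 3, 4)" and ?b = "gen n (1, 2, 3, 5)"
  have g: "(1, 2, 3, 4) \<in> gamma4_gens n" "(1, 2, 3, 5) \<in> gamma4_gens n"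
    using n by (auto simp: gamma4_gens_def)
  have "inv\<^bsub>Gamma4 n\<^esub> ?a = ?a" "inv\<^bsub>Gamma4 n\<^esub> ?b = ?b"
    by (rule inv_equality[OF gens_square[OF imageI[OF g(1)]] small_gens(1) small_gens(1)],
      rule inv_equality[OF gens_square[OF imageI[OF g(2)]] small_gens(2) small_gens(2)])
  then have "zeta = ?a \<otimes>\<^bsub>Gamma4 n\<^esub> ?b \<otimes>\<^bsub>Gamma4 n\<^esub> inv\<^bsub>Gamma4 n\<^esub> ?a \<otimes>\<^bsub>Gamma4 n\<^esub> inv\<^bsub>Gamma4 n\<^esub> ?b"
    unfolding zeta_eq using small_gens by (simp add: m_assoc)
  then have "zeta \<in> derived (Gamma4 n) (carrier (Gamma4 n))"
    unfolding derived_def using small_gens by (intro generate.incl) blast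
  moreover have "\<one>\<^bsub>Gamma4 n\<^esub> \<in> derived (Gamma4 n) (carrier (Gamma4 n))"
    unfolding derived_def by (rule generate.one)
  ultimately show "{\<one>\<^bsub>Gamma4 n\<^esub>, zeta} \<subseteq> derived (Gamma4 n) (carrier (Gamma4 n))" by simp
qed

lemma two_step_nilpotent_Gamma4: "two_step_nilpotent (Gamma4 n)"
  unfolding two_step_nilpotent_def
proof (intro conjI)
  show "group (Gamma4 n)" by (rule group_Gamma4)
  show "\<not> comm_group (Gamma4 n)"
  proof
    assume "comm_group (Gamma4 n)"
    then interpret comm_group "Gamma4 n" .
    let ?a = "gen n (1, 2, 3, 4)" and ?b = "gen n (1, 2, 3, 5)"
    have g: "(1, 2, 3, 4) \<in> gamma4_gens n" "(1, 2, 3, 5) \<in> gamma4_gens n"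
      using n by (auto simp: gamma4_gens_def)
    have sq: "?a \<otimes>\<^bsub>Gamma4 n\<^esub> ?a = \<one>\<^bsub>Gamma4 n\<^esub>" "?b \<otimes>\<^bsub>Gamma4 n\<^esub> ?b = \<one>\<^bsub>Gamma4 n\<^esub>"
      by (rule gens_square[OF imageI[OF g(1)]] gens_square[OF imageI[OF g(2)]])+
    have "zeta = (?a \<otimes>\<^bsub>Gamma4 n\<^esub> ?a) \<otimes>\<^bsub>Gamma4 n\<^esub> (?b \<otimes>\<^bsub>Gamma4 n\<^esub> ?b)"
      unfolding zeta_eq using small_gens by (simp add: m_ac del: One_nat_def)
    then show False using sq zeta_ne_one by simp
  qed
  show "derived (Gamma4 n) (carrier (Gamma4 n)) \<subseteq> center (Gamma4 n)"
    unfolding derived_Gamma4 center_def using zeta_in zeta_central by auto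
qed

lemma p_group_Gamma4: "p_group 2 (Gamma4 n)"
  unfolding p_group_def
proof (intro conjI ballI)
  show "group (Gamma4 n)" by (rule group_Gamma4)
  fix x assume "x \<in> carrier (Gamma4 n)"
  then have "ord x dvd 2 ^ (n choose 3)"
    using ord_dvd_group_order order_Gamma4(2) by (metis order_def)
  then show "\<exists>k. ord x = 2 ^ k"
    using divides_primepow_nat[of 2 "ord x" "n choose 3"] by auto
qed

lemma central_extension_Gamma4:
  "central_extension (integer_mod_group 2) (Gamma4 n) (abelianization (Gamma4 n))
     (\<lambda>i. if i = 0 then \<one>\<^bsub>Gamma4 n\<^esub> else zeta) (abelianization_map (Gamma4 n))"
  (is "central_extension ?Z2 _ ?A ?f ?p")
proof -
  let ?D = "derived (Gamma4 n) (carrier (Gamma4 n))"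
  interpret D: normal ?D "Gamma4 n"
    by (rule derived_self_is_normal)
  have carr: "carrier ?Z2 = {0, 1}"
    by (auto simp: carrier_integer_mod_group)
  have img: "?f ` carrier ?Z2 = ?D"
    unfolding derived_Gamma4 carr by auto
  have p: "?p = (#>\<^bsub>Gamma4 n\<^esub>) ?D"
    by (rule ext) (simp add: abelianization_map_def)
  show ?thesis
    unfolding central_extension_def
  proof (intro conjI)
    show "group_hom ?Z2 (Gamma4 n) ?f"
    proof (intro group_hom.intro group_hom_axioms.intro homI)
      show "?f x \<in> carrier (Gamma4 n)" for x using zeta_in by simp
      show "?f (x \<otimes>\<^bsub>?Z2\<^esub> y) = ?f x \<otimes>\<^bsub>Gamma4 n\<^esub> ?f y" if "x \<in> carrier ?Z2" "y \<in> carrier ?Z2" for x y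
      proof -
        have "x \<otimes>\<^bsub>?Z2\<^esub> y = (x + y) mod 2" by (simp add: mult_integer_mod_group)
        moreover have "x = 0 \<or> x = 1" "y = 0 \<or> y = 1" using that carr by auto
        ultimately show ?thesis using zeta_in zeta_square by (elim disjE) simp_all
      qed
    qed (auto simp: group_Gamma4)
    show "group_hom (Gamma4 n) ?A ?p"
      unfolding p abelianization_def
      by (intro group_hom.intro group_hom_axioms.intro group_Gamma4 D.factorgroup_is_group D.r_coset_hom_Mod)
    show "inj_on ?f (carrier ?Z2)"
      unfolding carr using zeta_ne_one by (auto simp: inj_on_def)
    show "?f ` carrier ?Z2 = kernel (Gamma4 n) ?A ?p"
    proof -
      have "kernel (Gamma4 n) ?A ?p = {x \<in> carrier (Gamma4 n). ?D #>\<^bsub>Gamma4 n\<^esub> x = ?D}"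
        by (simp add: kernel_def p abelianization_def FactGroup_def)
      also have "\<dots> = ?D"
      proof (intro equalityI subsetI)
        fix x assume "x \<in> {x \<in> carrier (Gamma4 n). ?D #>\<^bsub>Gamma4 n\<^esub> x = ?D}"
        then show "x \<in> ?D" using coset_join1[OF _ _ D.is_subgroup, of x] by simp
      next
        fix x assume x: "x \<in> ?D"
        then have "x \<in> carrier (Gamma4 n)" using D.subset by (rule subsetD[rotated])
        then show "x \<in> {x \<in> carrier (Gamma4 n). ?D #>\<^bsub>Gamma4 n\<^esub> x = ?D}"
          using coset_join2[OF _ D.is_subgroup x] by simp
      qed
      finally show ?thesis using img by simp
    qed
    show "?p ` carrier (Gamma4 n) = carrier ?A"
      by (auto simp: p abelianization_def FactGroup_def RCOSETS_def)
    show "?f ` carrier ?Z2 \<subseteq> center (Gamma4 n)"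
      unfolding img using two_step_nilpotent_Gamma4 by (simp add: two_step_nilpotent_def)
  qed
qed

end

theorem theorem1p2:
  fixes n :: nat
  assumes "n \<ge> 6"
  shows "finite (carrier (Gamma4 n)) \<and>
    two_step_nilpotent (Gamma4 n) \<and>
    p_group 2 (Gamma4 n) \<and>
    order (Gamma4 n) = 2 ^ (n choose 3) \<and>
    (\<exists>f. central_extension (integer_mod_group 2) (Gamma4 n) (abelianization (Gamma4 n))
           f (abelianization_map (Gamma4 n)))"
  using order_Gamma4[OF assms] two_step_nilpotent_Gamma4[OF assms] p_group_Gamma4[OF assms]
    central_extension_Gamma4[OF assms] unfolding order_def by blast

end
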